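(* Let $\Gamma$ be a group of Deligne-type, and let $1 \leq p \leq q \leq \infty$. If $\Gamma$ is $\mathscr{G}_q$-stable, then $\Gamma$ is not $\mathscr{G}_p$-approximated. In particular, if $\Gamma$ is Frobenius stable (that is, $\mathscr{G}_2$-stable), then $\Gamma$ is not $\mathscr{G}_p$-approximated for any $1 \leq p \leq 2$.
   Context: For $A \in M_n(\mathbb{C})$ let $|A| = \sqrt{A^*A}$. For $1 \leq p < \infty$ the (unnormalized) Schatten $p$-norm is $\|A\|_p = \operatorname{Tr}(|A|^p)^{1/p}$, and $\|A\|_\infty = \|A\|_{\mathrm{op}}$ is the operator norm; the Frobenius norm is $\|\cdot\|_2$. Let $\mathscr{G} = \{(G_n, d_n)\}_{n}$ be a family of groups $G_n$ with bi-invariant metrics $d_n$. An asymptotic homomorphism is a sequence of maps (not necessarily homomorphisms) $\varphi_n : \Gamma \to G_n$ such that $\lim_{n\to\infty} d_n(\varphi_n(gh), \varphi_n(g)\varphi_n(h)) = 0$ for all $g,h \in \Gamma$. The group $\Gamma$ is $\mathscr{G}$-approximated if there is an asymptotic homomorphism $\varphi_n : \Gamma \to G_n$ with $\liminf_n d_n(\varphi_n(g), 1_{G_n}) > 0$ for all $g \in \Gamma\setminus\{1\}$. The group $\Gamma$ is $\mathscr{G}$-stable if for every asymptotic homomorphism $\varphi_n : \Gamma \to G_n$ there are genuine homomorphisms $\psi_n : \Gamma \to G_n$ such that $\lim_{n} d_n(\varphi_n(g), \psi_n(g)) = 0$ for all $g \in \Gamma$. For $1 \le p \le \infty$, $\mathscr{G}_p$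 is the family $G_n = U(n)$ (unitary group) with $d_n(u,v) = \|u-v\|_p$. $\ker_{\mathrm{RF}}(\Gamma)$ is the kernel of the map from $\Gamma$ to its profinite completion, i.e. the set of elements of $\Gamma$ that are trivial in every finite quotient of $\Gamma$. A finitely generated group $\Gamma$ is of Deligne-type if there is a central element $J \in \Gamma$ of order $2$ such that $J \in \ker_{\mathrm{RF}}(\Gamma)$. *)

theory Defs
  imports
    "HOL-Algebra.Algebra"
    "HOL-Library.Extended_Real"
    "HOL-Library.Liminf_Limsup"
    "Jordan_Normal_Form.Schur_Decomposition"
begin

section \<open>Approximation and stability with respect to a metric family of groups\<close>

definition asymptotic_hom ::
  "(nat \<Rightarrow> ('g, 'h) monoid_scheme) \<Rightarrow> (nat \<Rightarrow> 'g \<Rightarrow> 'g \<Rightarrow> real) \<Rightarrow>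
    ('a, 'b) monoid_scheme \<Rightarrow> (nat \<Rightarrow> 'a \<Rightarrow> 'g) \<Rightarrow> bool"
where
  "asymptotic_hom \<G> d \<Gamma> \<phi> \<longleftrightarrow>
    (\<forall>n. \<phi> n \<in> carrier \<Gamma> \<rightarrow> carrier (\<G> n)) \<and>
    (\<forall>g\<in>carrier \<Gamma>. \<forall>h\<in>carrier \<Gamma>.
      (\<lambda>n. d n (\<phi> n (g \<otimes>\<^bsub>\<Gamma>\<^esub> h)) (\<phi> n g \<otimes>\<^bsub>\<G> n\<^esub> \<phi> n h)) \<longlonglongrightarrow> 0)"

definition approximated ::
  "(nat \<Rightarrow> ('g, 'h) monoid_scheme) \<Rightarrow> (nat \<Rightarrow> 'g \<Rightarrow> 'g \<Rightarrow> real) \<Rightarrow>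
    ('a, 'b) monoid_scheme \<Rightarrow> bool"
where
  "approximated \<G> d \<Gamma> \<longleftrightarrow>
    (\<exists>\<phi>. asymptotic_hom \<G> d \<Gamma> \<phi> \<and>
      (\<forall>g\<in>carrier \<Gamma> - {\<one>\<^bsub>\<Gamma>\<^esub>}. liminf (\<lambda>n. ereal (d n (\<phi> n g) \<one>\<^bsub>\<G> n\<^esub>)) > 0))"

definition stable ::
  "(nat \<Rightarrow> ('g, 'h) monoid_scheme) \<Rightarrow> (nat \<Rightarrow> 'g \<Rightarrow> 'g \<Rightarrow> real) \<Rightarrow>
    ('a, 'b) monoid_scheme \<Rightarrow> bool"
where
  "stable \<G> d \<Gamma> \<longleftrightarrow>
    (\<forall>\<phi>. asymptotic_hom \<G> d \<Gamma> \<phi> \<longrightarrow>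
      (\<exists>\<psi>. (\<forall>n. \<psi> n \<in> hom \<Gamma> (\<G> n)) \<and>
        (\<forall>g\<in>carrier \<Gamma>. (\<lambda>n. d n (\<phi> n g) (\<psi> n g)) \<longlonglongrightarrow> 0)))"


section \<open>Groups of Deligne type\<close>

definition finitely_generated_group :: "('a, 'b) monoid_scheme \<Rightarrow> bool" where
  "finitely_generated_group \<Gamma> \<longleftrightarrow>
    group \<Gamma> \<and> (\<exists>S. finite S \<and> S \<subseteq> carrier \<Gamma> \<and> generate \<Gamma> S = carrier \<Gamma>)"

definition ker_RF :: "('a, 'b) monoid_scheme \<Rightarrow> 'a set" where
  "ker_RF \<Gamma> = {g \<in> carrier \<Gamma>.
     \<forall>N. N \<lhd> \<Gamma> \<and> finite (carrier (\<Gamma> Mod N)) \<longrightarrow> N #>\<^bsub>\<Gamma>\<^esub> g = \<one>\<^bsub>\<Gamma> Mod N\<^esub>}"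

definition deligne_type :: "('a, 'b) monoid_scheme \<Rightarrow> bool" where
  "deligne_type \<Gamma> \<longleftrightarrow>
    finitely_generated_group \<Gamma> \<and>
    (\<exists>J\<in>carrier \<Gamma>. (\<forall>g\<in>carrier \<Gamma>. J \<otimes>\<^bsub>\<Gamma>\<^esub> g = g \<otimes>\<^bsub>\<Gamma>\<^esub> J) \<and>
      group.ord \<Gamma> J = 2 \<and> J \<in> ker_RF \<Gamma>)"


section \<open>Unitary groups with Schatten distances\<close>

definition unitary_group :: "nat \<Rightarrow> complex mat monoid" where
  "unitary_group n =
    \<lparr>carrier = {U \<in> carrier_mat n n. mat_adjoint U * U = 1\<^sub>m n \<and> U * mat_adjoint U = 1\<^sub>m n},
     monoid.mult = (*), one = 1\<^sub>m n\<rparr>"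

text \<open>
  Continuous functional calculus: if \<open>H = U D U\<^sup>*\<close> with \<open>U\<close> unitary and \<open>D\<close> real diagonal, then
  \<open>f(H) = U f(D) U\<^sup>*\<close>, which does not depend on the diagonalisation (lemma \<open>herm_fun_eqI\<close>).
  Meaningful only for Hermitian \<open>H\<close>.
\<close>

definition herm_fun :: "(real \<Rightarrow> real) \<Rightarrow> complex mat \<Rightarrow> complex mat" where
  "herm_fun f H = (THE B. \<exists>U \<in> carrier (unitary_group (dim_row H)). \<exists>d :: nat \<Rightarrow> real.
     H = U * mat_diag (dim_row H) (\<lambda>i. complex_of_real (d i)) * mat_adjoint U \<and>
     B = U * mat_diag (dim_row H) (\<lambda>i. complex_of_real (f (d i))) * mat_adjoint U)"

definition abs_mat :: "complex mat \<Rightarrow> complex mat" where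
  "abs_mat A = herm_fun sqrt (mat_adjoint A * A)"

definition mat_trace :: "complex mat \<Rightarrow> complex" where
  "mat_trace A = (\<Sum>i<dim_row A. A $$ (i, i))"

definition eucl_norm :: "complex vec \<Rightarrow> real" where
  "eucl_norm v = sqrt (\<Sum>i<dim_vec v. (cmod (v $ i))\<^sup>2)"

definition op_norm :: "complex mat \<Rightarrow> real" where
  "op_norm A = (SUP v \<in> {v \<in> carrier_vec (dim_col A). eucl_norm v \<le> 1}. eucl_norm (A *\<^sub>v v))"

text \<open>The trace of \<open>|A|\<^sup>p\<close> is real and nonnegative, so taking \<open>Re\<close> loses nothing.\<close>

definition schatten_norm :: "ereal \<Rightarrow> complex mat \<Rightarrow> real" where
  "schatten_norm p A =
    (if p = \<infinity> then op_norm A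
     else Re (mat_trace (herm_fun (\<lambda>x. x powr real_of_ereal p) (abs_mat A)))
            powr (1 / real_of_ereal p))"

definition schatten_dist :: "ereal \<Rightarrow> nat \<Rightarrow> complex mat \<Rightarrow> complex mat \<Rightarrow> real" where
  "schatten_dist p n U V = schatten_norm p (U - V)"

text \<open>
  The index \<open>n = 0\<close> is included in the family; \<open>U(0)\<close> is trivial, and no single index affects
  approximation or stability.
\<close>

abbreviation schatten_approximated :: "ereal \<Rightarrow> ('a, 'b) monoid_scheme \<Rightarrow> bool" where
  "schatten_approximated p \<Gamma> \<equiv> approximated unitary_group (schatten_dist p) \<Gamma>"

abbreviation schatten_stable :: "ereal \<Rightarrow> ('a, 'b) monoid_scheme \<Rightarrow> bool" where
  "schatten_stable p \<Gamma> \<equiv> stable unitary_group (schatten_dist p) \<Gamma>"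

abbreviation frobenius_stable :: "('a, 'b) monoid_scheme \<Rightarrow> bool" where
  "frobenius_stable \<Gamma> \<equiv> schatten_stable 2 \<Gamma>"

lemma mat_adjoint_carrier: "A \<in> carrier_mat n m \<Longrightarrow> mat_adjoint A \<in> carrier_mat m n"
  unfolding mat_adjoint_def by auto

lemma diag_conj_unique:
  fixes f :: "real \<Rightarrow> real" and a b :: "nat \<Rightarrow> real"
  assumes U: "U \<in> carrier (unitary_group n)" and V: "V \<in> carrier (unitary_group n)"
    and eq: "U * mat_diag n (\<lambda>i. complex_of_real (a i)) * mat_adjoint U
           = V * mat_diag n (\<lambda>i. complex_of_real (b i)) * mat_adjoint V"
  shows "U * mat_diag n (\<lambda>i. complex_of_real (f (a i))) * mat_adjoint U
       = V * mat_diag n (\<lambda>i. complex_of_real (f (b i))) * mat_adjoint V"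
proof -
  define Da where "Da g = mat_diag n (\<lambda>i. complex_of_real (g (a i)))" for g :: "real \<Rightarrow> real"
  define Db where "Db g = mat_diag n (\<lambda>i. complex_of_real (g (b i)))" for g :: "real \<Rightarrow> real"
  define U' where "U' = mat_adjoint U"
  define V' where "V' = mat_adjoint V"
  have c[simp]: "U \<in> carrier_mat n n" "V \<in> carrier_mat n n"
      "U' \<in> carrier_mat n n" "V' \<in> carrier_mat n n"
      "\<And>g. Da g \<in> carrier_mat n n" "\<And>g. Db g \<in> carrier_mat n n"
    using U V by (auto simp: unitary_group_def U'_def V'_def Da_def Db_def mat_adjoint_carrier)
  have u: "U' * U = 1\<^sub>m n" "U * U' = 1\<^sub>m n" "V' * V = 1\<^sub>m n" "V * V' = 1\<^sub>m n"
    using U V by (auto simp: unitary_group_def U'_def V'_def)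
  note as = assoc_mult_mat[of _ n n _ n _ n] right_mult_one_mat[of _ n n] left_mult_one_mat[of _ n n]
  define W where "W = V' * U"
  have m[simp]: "A * B \<in> carrier_mat n n"
    if "A \<in> carrier_mat n n" "B \<in> carrier_mat n n" for A B :: "complex mat"
    using that by (rule mult_carrier_mat)
  have W[simp]: "W \<in> carrier_mat n n" by (simp add: W_def)
  have eq': "U * Da id * U' = V * Db id * V'"
    using eq by (simp add: Da_def Db_def U'_def V'_def)
  have "V' * (U * Da id * U') * U = V' * (V * Db id * V') * U" by (simp add: eq')
  moreover have "V' * (U * Da id * U') * U = W * Da id"
    by (simp add: as W_def u)
  moreover have "V' * (V * Db id * V') * U = (V' * V) * Db id * (V' * U)"
    by (simp add: as)
  ultimately have comm: "W * Da id = Db id * W" by (simp add: as u W_def)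
  have ent: "W $$ (i,j) * complex_of_real (a j) = complex_of_real (b i) * W $$ (i,j)"
    if "i < n" "j < n" for i j
  proof -
    have "(W * Da id) $$ (i,j) = (Db id * W) $$ (i,j)" by (simp add: comm)
    then show ?thesis
      using that unfolding Da_def Db_def
      by (simp add: mat_diag_mult_left[OF W] mat_diag_mult_right[OF W])
  qed
  have comm': "W * Da f = Db f * W"
  proof (rule eq_matI)
    fix i j assume "i < dim_row (Db f * W)" "j < dim_col (Db f * W)"
    then have ij: "i < n" "j < n"
      using c(6)[of f] W by (auto simp del: c W)
    have "W $$ (i,j) = 0 \<or> a j = b i" using ent[OF ij] by auto
    then show "(W * Da f) $$ (i,j) = (Db f * W) $$ (i,j)"
      using ij unfolding Da_def Db_def
      by (auto simp: mat_diag_mult_left[OF W] mat_diag_mult_right[OF W])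
  qed (use c(5)[of f] c(6)[of f] W in \<open>auto simp del: c W\<close>)
  have "V * (W * Da f) * U' = V * (Db f * W) * U'" by (simp add: comm')
  moreover have "V * (W * Da f) * U' = (V * V') * U * Da f * U'"
    by (simp add: as W_def)
  moreover have "V * (Db f * W) * U' = V * Db f * V' * (U * U')"
    by (simp add: as W_def)
  ultimately have "U * Da f * U' = V * Db f * V'" by (simp add: as u)
  then show ?thesis by (simp add: Da_def Db_def U'_def V'_def)
qed

lemma herm_fun_eqI:
  assumes U: "U \<in> carrier (unitary_group n)"
    and H: "H = U * mat_diag n (\<lambda>i. complex_of_real (d i)) * mat_adjoint U"
  shows "herm_fun f H = U * mat_diag n (\<lambda>i. complex_of_real (f (d i))) * mat_adjoint U"
proof -
  have n: "dim_row H = n" using U unfolding H by (auto simp: unitary_group_def)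
  show ?thesis
    unfolding herm_fun_def n
  proof (rule the_equality)
    show "\<exists>V\<in>carrier (unitary_group n). \<exists>e. H = V * mat_diag n (\<lambda>i. complex_of_real (e i)) * mat_adjoint V \<and>
        U * mat_diag n (\<lambda>i. complex_of_real (f (d i))) * mat_adjoint U
        = V * mat_diag n (\<lambda>i. complex_of_real (f (e i))) * mat_adjoint V"
      using U H by blast
  next
    fix B
    assume "\<exists>V\<in>carrier (unitary_group n). \<exists>e. H = V * mat_diag n (\<lambda>i. complex_of_real (e i)) * mat_adjoint V \<and>
        B = V * mat_diag n (\<lambda>i. complex_of_real (f (e i))) * mat_adjoint V"
    then show "B = U * mat_diag n (\<lambda>i. complex_of_real (f (d i))) * mat_adjoint U"
      using diag_conj_unique[OF U] H by metis
  qed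
qed

end

theory Submission
  imports
    Defs
    "HOL-Computational_Algebra.Computational_Algebra"
    "HOL-Analysis.Convex"
begin

text \<open>
  Let \<open>J\<close> be a central involution of \<open>\<Gamma>\<close> that dies in every finite quotient, and let \<open>\<phi>\<^sub>n\<close> be an
  asymptotic homomorphism in the Schatten \<open>p\<close>-norm.  Since the \<open>q\<close>-norm is at most the \<open>p\<close>-norm
  for \<open>p \<le> q\<close> (\<open>schatten_norm_antimono\<close>), the same maps form an asymptotic homomorphism in the
  \<open>q\<close>-norm, and \<open>q\<close>-stability supplies genuine homomorphisms \<open>\<psi>\<^sub>n : \<Gamma> \<rightarrow> U(n)\<close> close to them.

  By Malcev's theorem a finitely generated group of complex matrices is residually finite, so
  \<open>\<psi>\<^sub>n(J) = 1\<close> (\<open>hom_unitary_ker_RF\<close>) and the \<open>q\<close>-norm of \<open>\<phi>\<^sub>n(J) - 1\<close> tends to \<open>0\<close>.  For \<open>p < q\<close>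
  this alone says nothing about the \<open>p\<close>-norm, but \<open>\<phi>\<^sub>n(J)\<close> is almost an involution: with
  \<open>U = \<phi>\<^sub>n(J)\<close>, the matrix \<open>U\<^sup>2 - 1 = (U - 1)(U + 1)\<close> is small in the \<open>p\<close>-norm.  All eigenvalues
  \<open>1 + s\<close> of \<open>U\<close> satisfy \<open>\<bar>s\<bar> < 1\<close> as soon as the \<open>q\<close>-norm of \<open>U - 1\<close> is less than \<open>1\<close>, hence
  \<open>\<bar>2 + s\<bar> \<ge> 1\<close> and \<open>\<bar>s\<bar> \<le> \<bar>s (2 + s)\<bar>\<close>: the \<open>p\<close>-norm of \<open>U - 1\<close> is controlled by that of
  \<open>U\<^sup>2 - 1\<close> and tends to \<open>0\<close> as well (\<open>dist_one_le_of_almost_involution\<close>).  So \<open>\<phi>\<^sub>n\<close> does not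
  separate \<open>J\<close> from \<open>1\<close>.

  Malcev's theorem is reduced to commutative algebra: every finite set of complex numbers lies in a
  subring \<open>A\<close> in which each \<open>a \<noteq> 0\<close> becomes a unit modulo some proper ideal of finite index
  (\<open>finite_subset_residually_invertible_subring\<close>).  This is the Nullstellensatz for finitely
  generated \<open>\<int>\<close>-algebras without zero divisors.  It is proved by adjoining one generator at a time,
  starting from \<open>\<int>\<close>; demanding a unit, and not just a nonzero residue, is what makes the induction
  go through, because leading coefficients must stay invertible.

  The Schatten norms enter only for differences of unitary matrices \<open>U - V = V (V\<^sup>* U - 1)\<close>.
  Diagonalizing the unitary matrix \<open>V\<^sup>* U\<close> gives \<open>U - V = W diag(s) Z\<^sup>*\<close> with \<open>W\<close>, \<open>Z\<close> unitary, so
  that every Schatten norm of \<open>U - V\<close> is the corresponding \<open>\<ell>\<^sup>p\<close> norm of \<open>s\<close>.  Sums of such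
  differences are estimated through their diagonals: in any orthonormal basis, the \<open>\<ell>\<^sup>p\<close> norm of the
  diagonal is at most the Schatten norm of the matrix (\<open>sum_powr_diagonal_le\<close>).
\<close>

section \<open>Residue rings of finitely generated domains\<close>

definition subring_of :: "'a::comm_ring_1 set \<Rightarrow> bool" where
  "subring_of A \<longleftrightarrow> 1 \<in> A \<and> (\<forall>a\<in>A. \<forall>b\<in>A. a - b \<in> A \<and> a * b \<in> A)"

definition ideal_of :: "'a::comm_ring_1 set \<Rightarrow> 'a set \<Rightarrow> bool" where
  "ideal_of A I \<longleftrightarrow> I \<subseteq> A \<and> 0 \<in> I \<and> (\<forall>a\<in>I. \<forall>b\<in>I. a - b \<in> I) \<and> (\<forall>a\<in>A. \<forall>b\<in>I. a * b \<in> I)"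

definition finite_index :: "'a::comm_ring_1 set \<Rightarrow> 'a set \<Rightarrow> bool" where
  "finite_index A I \<longleftrightarrow> (\<exists>F. finite F \<and> F \<subseteq> A \<and> (\<forall>a\<in>A. \<exists>f\<in>F. a - f \<in> I))"

text \<open>
  Equivalently, every nonzero \<open>a \<in> A\<close> avoids some maximal ideal with finite residue field: in a finite
  nonzero quotient a unit stays a unit modulo any maximal ideal.
\<close>

definition residually_invertible :: "'a::comm_ring_1 set \<Rightarrow> bool" where
  "residually_invertible A \<longleftrightarrow> (\<forall>a\<in>A. a \<noteq> 0 \<longrightarrow>
     (\<exists>I. ideal_of A I \<and> 1 \<notin> I \<and> finite_index A I \<and> (\<exists>b\<in>A. a * b - 1 \<in> I)))"

definition polys_over :: "'a::comm_ring_1 set \<Rightarrow> 'a poly set" where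
  "polys_over A = {p. \<forall>i. coeff p i \<in> A}"

lemma subring_of_simps:
  assumes "subring_of A"
  shows "0 \<in> A" "1 \<in> A" "a \<in> A \<Longrightarrow> b \<in> A \<Longrightarrow> a - b \<in> A" "a \<in> A \<Longrightarrow> b \<in> A \<Longrightarrow> a * b \<in> A"
    "a \<in> A \<Longrightarrow> - a \<in> A" "a \<in> A \<Longrightarrow> b \<in> A \<Longrightarrow> a + b \<in> A" "a \<in> A \<Longrightarrow> a ^ k \<in> A"
proof -
  show 1: "1 \<in> A" and d: "a \<in> A \<Longrightarrow> b \<in> A \<Longrightarrow> a - b \<in> A" and m: "a \<in> A \<Longrightarrow> b \<in> A \<Longrightarrow> a * b \<in> A" for a b
    using assms by (auto simp: subring_of_def)
  show z: "0 \<in> A" using d[OF 1 1] by simp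
  show n: "a \<in> A \<Longrightarrow> - a \<in> A" for a using d[OF z, of a] by simp
  show "a \<in> A \<Longrightarrow> b \<in> A \<Longrightarrow> a + b \<in> A" using d[OF _ n, of a b] by simp
  show "a \<in> A \<Longrightarrow> a ^ k \<in> A" by (induction k) (auto simp: 1 m)
qed

lemma ideal_of_simps:
  assumes "ideal_of A I"
  shows "0 \<in> I" "a \<in> I \<Longrightarrow> b \<in> I \<Longrightarrow> a - b \<in> I" "a \<in> A \<Longrightarrow> b \<in> I \<Longrightarrow> a * b \<in> I"
    "b \<in> I \<Longrightarrow> a \<in> A \<Longrightarrow> b * a \<in> I"
    "a \<in> I \<Longrightarrow> - a \<in> I" "a \<in> I \<Longrightarrow> b \<in> I \<Longrightarrow> a + b \<in> I" "a \<in> I \<Longrightarrow> a \<in> A"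
proof -
  show z: "0 \<in> I" and d: "a \<in> I \<Longrightarrow> b \<in> I \<Longrightarrow> a - b \<in> I" and m: "a \<in> A \<Longrightarrow> b \<in> I \<Longrightarrow> a * b \<in> I" for a b
    using assms by (auto simp: ideal_of_def)
  show "b \<in> I \<Longrightarrow> a \<in> A \<Longrightarrow> b * a \<in> I" using m[of a b] by (simp add: mult.commute)
  show n: "a \<in> I \<Longrightarrow> - a \<in> I" for a using d[OF z, of a] by simp
  show "a \<in> I \<Longrightarrow> b \<in> I \<Longrightarrow> a + b \<in> I" using d[OF _ n, of a b] by simp
  show "a \<in> I \<Longrightarrow> a \<in> A" using assms by (auto simp: ideal_of_def)
qed

lemma ideal_of_self: "subring_of A \<Longrightarrow> ideal_of A A"
  using subring_of_simps by (auto simp: ideal_of_def)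

lemma ideal_of_sum:
  assumes "ideal_of A I" "\<And>i. i \<in> S \<Longrightarrow> f i \<in> I"
  shows "sum f S \<in> I"
  using assms(2)
  by (induction S rule: infinite_finite_induct) (auto intro!: ideal_of_simps[OF assms(1)])

lemma polys_over_mult:
  assumes I: "ideal_of A I" and p: "p \<in> polys_over A" and q: "q \<in> polys_over I"
  shows "p * q \<in> polys_over I"
  using p q by (auto simp: polys_over_def coeff_mult intro!: ideal_of_sum[OF I] ideal_of_simps(3)[OF I])

lemma polys_over_simps:
  assumes I: "ideal_of A I"
  shows "0 \<in> polys_over I" "p \<in> polys_over I \<Longrightarrow> q \<in> polys_over I \<Longrightarrow> p - q \<in> polys_over I"
    "p \<in> polys_over I \<Longrightarrow> q \<in> polys_over I \<Longrightarrow> p + q \<in> polys_over I"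
    "p \<in> polys_over I \<Longrightarrow> - p \<in> polys_over I"
    "a \<in> A \<Longrightarrow> q \<in> polys_over I \<Longrightarrow> smult a q \<in> polys_over I"
    "a \<in> I \<Longrightarrow> q \<in> polys_over I \<Longrightarrow> pCons a q \<in> polys_over I"
    "a \<in> I \<Longrightarrow> monom a k \<in> polys_over I"
  using ideal_of_simps[OF I]
  by (auto simp: polys_over_def coeff_pCons split: nat.split)

text \<open>
  Division with remainder by \<open>g\<close> becomes possible after multiplying by a power of its leading
  coefficient.  Coefficients of the dividend in an ideal \<open>I\<close> stay in \<open>I\<close> throughout; the case \<open>I = A\<close>
  is the usual pseudo-division over \<open>A\<close>.
\<close>

lemma pseudo_division:
  fixes g :: "'a::idom poly"
  assumes A: "subring_of A" and I: "ideal_of A I"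
    and g: "g \<in> polys_over A" "g \<noteq> 0" and p: "p \<in> polys_over I"
  shows "\<exists>k. \<exists>s\<in>polys_over I. \<exists>r\<in>polys_over I.
    (r = 0 \<or> degree r < degree g) \<and> smult (lead_coeff g ^ k) p = s * g + r"
  using p
proof (induction "degree p" arbitrary: p rule: less_induct)
  case less
  note c = polys_over_simps[OF I]
  show ?case
  proof (cases "p = 0 \<or> degree p < degree g")
    case True
    have "smult (lead_coeff g ^ 0) p = 0 * g + p" by simp
    then show ?thesis using True less.prems c(1) by blast
  next
    case False
    let ?a = "lead_coeff g" and ?d = "degree p - degree g"
    have aA: "?a \<in> A" and gi: "\<And>i. coeff g i \<in> A" using g by (auto simp: polys_over_def)
    have lp: "lead_coeff p \<in> I" using less.prems by (auto simp: polys_over_def)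
    define m where "m = monom (lead_coeff p) ?d"
    have m: "m \<in> polys_over I" unfolding m_def by (intro c lp)
    define p' where "p' = smult ?a p - m * g"
    have p': "p' \<in> polys_over I"
      unfolding p'_def using polys_over_mult[OF I g(1) m] less.prems aA
      by (auto intro!: c simp: mult.commute)
    have "p' = 0 \<or> degree p' < degree p"
    proof (cases "degree p = 0")
      case True
      then have "degree g = 0" using False by auto
      then obtain u v where "g = [:u:]" "p = [:v:]" using True by (metis degree_eq_zeroE)
      then have "p' = 0" by (simp add: p'_def m_def monom_0)
      then show ?thesis ..
    next
      case dp: False
      have 1: "degree (m * g) \<le> degree p"
        using False degree_mult_le[of m g] degree_monom_le[of "lead_coeff p" ?d]
        unfolding m_def by linarith
      have 2: "coeff (m * g) (degree p) = lead_coeff p * ?a"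
        using False by (simp add: m_def coeff_monom_mult)
      have "degree p' \<le> degree p" unfolding p'_def
        using 1 by (intro degree_diff_le) (auto simp: degree_smult_le)
      moreover have "coeff p' (degree p) = 0" by (simp add: p'_def 2)
      ultimately show ?thesis using dp
        by (metis le_neq_implies_less leading_coeff_0_iff)
    qed
    then show ?thesis
    proof
      assume "p' = 0"
      then have "smult (?a ^ 1) p = m * g + 0" by (simp add: p'_def)
      then show ?thesis using m c(1) by blast
    next
      assume "degree p' < degree p"
      from less.hyps[OF this p'] obtain k s r where
        s: "s \<in> polys_over I" and r: "r \<in> polys_over I" "r = 0 \<or> degree r < degree g"
        and e: "smult (?a ^ k) p' = s * g + r" by blast
      have "smult (?a ^ Suc k) p = smult (?a ^ k) (p' + m * g)"
        by (simp add: p'_def mult.commute)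
      also have "\<dots> = (s + smult (?a ^ k) m) * g + r"
        by (simp add: smult_add_right e algebra_simps)
      finally show ?thesis
        using r by (intro exI bexI[OF _ c(3)[OF s c(5)[OF subring_of_simps(7)[OF A aA] m]]] bexI[OF _ r(1)] conjI r(2))
    qed
  qed
qed

definition adjoin :: "'a::comm_ring_1 set \<Rightarrow> 'a \<Rightarrow> 'a set" where
  "adjoin A x = (\<lambda>p. poly p x) ` polys_over A"

lemma adjoin_intro: "p \<in> polys_over A \<Longrightarrow> poly p x \<in> adjoin A x"
  by (auto simp: adjoin_def)

lemma adjoin_subring:
  assumes A: "subring_of A"
  shows "subring_of (adjoin A x)" "A \<subseteq> adjoin A x" "x \<in> adjoin A x"
proof -
  note S = ideal_of_self[OF A] and a = subring_of_simps[OF A]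
  note c = polys_over_simps[OF S] polys_over_mult[OF S]
  show sub: "A \<subseteq> adjoin A x"
  proof
    fix a assume "a \<in> A"
    then have "poly [:a:] x \<in> adjoin A x" by (intro adjoin_intro c)
    then show "a \<in> adjoin A x" by simp
  qed
  have "poly [:0, 1:] x \<in> adjoin A x" by (intro adjoin_intro c a)
  then show "x \<in> adjoin A x" by simp
  show "subring_of (adjoin A x)" unfolding subring_of_def
  proof (intro conjI ballI)
    show "1 \<in> adjoin A x" using sub a by auto
    fix u v assume "u \<in> adjoin A x" "v \<in> adjoin A x"
    then obtain p q where pq: "u = poly p x" "v = poly q x" "p \<in> polys_over A" "q \<in> polys_over A"
      by (auto simp: adjoin_def)
    have "poly (p - q) x \<in> adjoin A x" "poly (p * q) x \<in> adjoin A x"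
      by (intro adjoin_intro c(2,8) pq)+
    then show "u - v \<in> adjoin A x" "u * v \<in> adjoin A x" using pq by auto
  qed
qed

text \<open>
  The ideal of \<open>A[x]\<close> generated by \<open>I\<close> and \<open>f(x)\<close>.
\<close>

definition adjoin_ideal :: "'a::comm_ring_1 set \<Rightarrow> 'a set \<Rightarrow> 'a poly \<Rightarrow> 'a \<Rightarrow> 'a set" where
  "adjoin_ideal A I f x = {poly (q + s * f) x | q s. q \<in> polys_over I \<and> s \<in> polys_over A}"

lemma adjoin_idealI:
  "q \<in> polys_over I \<Longrightarrow> s \<in> polys_over A \<Longrightarrow> poly (q + s * f) x \<in> adjoin_ideal A I f x"
  unfolding adjoin_ideal_def by blast

lemma adjoin_ideal_is_ideal:
  assumes A: "subring_of A" and I: "ideal_of A I" and f: "f \<in> polys_over A"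
  shows "ideal_of (adjoin A x) (adjoin_ideal A I f x)"
proof -
  note S = ideal_of_self[OF A]
  note cA = polys_over_simps[OF S] polys_over_mult[OF S] and cI = polys_over_simps[OF I] polys_over_mult[OF I]
  have IA: "q \<in> polys_over I \<Longrightarrow> q \<in> polys_over A" for q
    using ideal_of_simps(7)[OF I] by (auto simp: polys_over_def)
  show ?thesis unfolding ideal_of_def
  proof (intro conjI ballI subsetI)
    fix u assume "u \<in> adjoin_ideal A I f x"
    then obtain q s where u: "u = poly (q + s * f) x" and m: "q \<in> polys_over I" "s \<in> polys_over A"
      by (auto simp: adjoin_ideal_def)
    show "u \<in> adjoin A x"
      unfolding u by (intro adjoin_intro cA(3)[OF IA[OF m(1)]] cA(8)[OF m(2) f])
  next
    show "0 \<in> adjoin_ideal A I f x"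
      using adjoin_idealI[OF cI(1) cA(1), of f x] by simp
  next
    fix u v assume "u \<in> adjoin_ideal A I f x" "v \<in> adjoin_ideal A I f x"
    then obtain q s q' s' where e: "u = poly (q + s * f) x" "v = poly (q' + s' * f) x"
      and m: "q \<in> polys_over I" "s \<in> polys_over A" "q' \<in> polys_over I" "s' \<in> polys_over A"
      by (auto simp: adjoin_ideal_def)
    have "u - v = poly ((q - q') + (s - s') * f) x" by (simp add: e algebra_simps)
    then show "u - v \<in> adjoin_ideal A I f x"
      using adjoin_idealI[OF cI(2)[OF m(1,3)] cA(2)[OF m(2,4)]] by (simp only:)
  next
    fix u v assume "u \<in> adjoin A x" "v \<in> adjoin_ideal A I f x"
    then obtain p q s where e: "u = poly p x" "v = poly (q + s * f) x"
      and m: "p \<in> polys_over A" "q \<in> polys_over I" "s \<in> polys_over A"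
      by (auto simp: adjoin_ideal_def adjoin_def)
    have "u * v = poly (p * q + (p * s) * f) x" by (simp add: e algebra_simps)
    then show "u * v \<in> adjoin_ideal A I f x"
      using adjoin_idealI[OF cI(8)[OF m(1,2)] cA(8)[OF m(1,3)]] by (simp only:)
  qed
qed

lemma adjoin_ideal_intros:
  assumes A: "subring_of A" and I: "ideal_of A I"
  shows "q \<in> polys_over I \<Longrightarrow> poly q x \<in> adjoin_ideal A I f x"
    "s \<in> polys_over A \<Longrightarrow> poly s x * poly f x \<in> adjoin_ideal A I f x"
    "a \<in> I \<Longrightarrow> a \<in> adjoin_ideal A I f x"
proof -
  note cA = polys_over_simps[OF ideal_of_self[OF A]] and cI = polys_over_simps[OF I]
  show q: "q \<in> polys_over I \<Longrightarrow> poly q x \<in> adjoin_ideal A I f x" for q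
    using adjoin_idealI[OF _ cA(1), of q I f x] by simp
  show "s \<in> polys_over A \<Longrightarrow> poly s x * poly f x \<in> adjoin_ideal A I f x"
    using adjoin_idealI[OF cI(1), of s A f x] by simp
  show "a \<in> I \<Longrightarrow> a \<in> adjoin_ideal A I f x"
    using q[OF cI(6)[OF _ cI(1)], of a] by simp
qed

lemma power_cong_one:
  assumes A: "subring_of A" and I: "ideal_of A I" and u: "u \<in> A" "u - 1 \<in> I"
  shows "u ^ k - 1 \<in> I"
proof (induction k)
  case 0 then show ?case using ideal_of_simps(1)[OF I] by simp
next
  case (Suc k)
  have "u ^ Suc k - 1 = u * (u ^ k - 1) + (u - 1)" by (simp add: algebra_simps)
  moreover have "u * (u ^ k - 1) + (u - 1) \<in> I"
    by (intro ideal_of_simps(6)[OF I] ideal_of_simps(3)[OF I u(1)] Suc u)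
  ultimately show ?case by (simp only:)
qed

lemma poly_eq_sum_upto:
  fixes p :: "'a::comm_ring_1 poly"
  assumes "degree p \<le> m"
  shows "poly p x = (\<Sum>i\<le>m. coeff p i * x ^ i)"
  unfolding poly_altdef
proof (rule sum.mono_neutral_left)
  show "finite {..m}" by simp
  show "{..degree p} \<subseteq> {..m}" using assms by simp
  show "\<forall>i\<in>{..m} - {..degree p}. coeff p i * x ^ i = 0"
    by (simp add: coeff_eq_0)
qed

text \<open>
  If the leading coefficient of \<open>f\<close> is a unit modulo \<open>I\<close>, then modulo \<open>I\<close> and \<open>f(x)\<close> every element
  of \<open>A[x]\<close> is a polynomial in \<open>x\<close> of degree at most that of \<open>f\<close>, whose coefficients can moreover be
  taken among finitely many representatives of \<open>A\<close> modulo \<open>I\<close>.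
\<close>

lemma adjoin_ideal_finite_index:
  fixes f :: "'a::idom poly"
  assumes A: "subring_of A" and I: "ideal_of A I" and f: "f \<in> polys_over A" "f \<noteq> 0"
    and fin: "finite_index A I"
    and inv: "a' \<in> A" "lead_coeff f * a' - 1 \<in> I"
  shows "finite_index (adjoin A x) (adjoin_ideal A I f x)"
proof -
  let ?B = "adjoin A x" and ?J = "adjoin_ideal A I f x" and ?m = "degree f" and ?a = "lead_coeff f"
  note S = ideal_of_self[OF A]
  note sA = subring_of_simps[OF A]
  note B = adjoin_subring[OF A, of x]
  note J = adjoin_ideal_is_ideal[OF A I f(1), of x]
  note sJ = ideal_of_simps[OF J]
  note iJ = adjoin_ideal_intros[OF A I]
  have aA: "?a \<in> A" using f by (auto simp: polys_over_def)
  obtain F where F: "finite F" "F \<subseteq> A" "\<And>a. a \<in> A \<Longrightarrow> \<exists>f\<in>F. a - f \<in> I"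
    using fin unfolding finite_index_def by metis
  define rep where "rep a = (SOME f. f \<in> F \<and> a - f \<in> I)" for a
  have rep: "rep a \<in> F" "a - rep a \<in> I" if "a \<in> A" for a
    using F(3)[OF that] unfolding rep_def by (metis (mono_tags, lifting) someI)+
  define R where "R = (\<lambda>c. \<Sum>i\<le>?m. c i * x ^ i) ` ({..?m} \<rightarrow>\<^sub>E F)"
  have Rfin: "finite R" unfolding R_def by (intro finite_imageI finite_PiE) (use F in auto)
  have RB: "R \<subseteq> ?B"
  proof
    fix y assume "y \<in> R"
    then obtain c where y: "y = (\<Sum>i\<le>?m. c i * x ^ i)" and c: "\<And>i. i \<le> ?m \<Longrightarrow> c i \<in> F"
      by (auto simp: R_def)
    show "y \<in> ?B" unfolding y
      using c F(2) B(2) subring_of_simps(7)[OF B(1) B(3)]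
      by (intro ideal_of_sum[OF ideal_of_self[OF B(1)]] subring_of_simps(4)[OF B(1)]) auto
  qed
  have cover: "\<exists>r\<in>R. y - r \<in> ?J" if "y \<in> ?B" for y
  proof -
    obtain p where p: "p \<in> polys_over A" and y: "y = poly p x" using \<open>y \<in> ?B\<close> by (auto simp: adjoin_def)
    obtain k s r where s: "s \<in> polys_over A" and r: "r \<in> polys_over A" "r = 0 \<or> degree r < ?m"
      and e: "smult (?a ^ k) p = s * f + r"
      using pseudo_division[OF A S f p] by blast
    \<comment> \<open>Undo the factor \<open>lead_coeff f ^ k\<close> of the pseudo-division with the inverse \<open>a'\<close>.\<close>
    define t where "t = smult (a' ^ k) r"
    have t: "t \<in> polys_over A" "degree t \<le> ?m"
      using r sA(7)[OF inv(1)] polys_over_simps(5)[OF S] degree_smult_le[of "a'^k" r] by (auto simp: t_def)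
    then have tc: "coeff t i \<in> A" for i by (auto simp: polys_over_def)
    define c where "c = restrict (\<lambda>i. rep (coeff t i)) {..?m}"
    define z where "z = (\<Sum>i\<le>?m. c i * x ^ i)"
    have zR: "z \<in> R" unfolding R_def z_def by (rule imageI) (unfold c_def restrict_PiE_iff, use rep(1)[OF tc] in simp)
    have "poly t x = (\<Sum>i\<le>?m. coeff t i * x ^ i)"
      by (rule poly_eq_sum_upto[OF t(2)])
    then have "poly t x - z = (\<Sum>i\<le>?m. (coeff t i - c i) * x ^ i)"
      by (simp only: z_def sum_subtractf left_diff_distrib)
    also have "\<dots> \<in> ?J"
      using rep(2)[OF tc] subring_of_simps(7)[OF B(1) B(3)]
      by (intro ideal_of_sum[OF J] sJ(4)) (auto simp: c_def intro: iJ(3))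
    finally have 1: "poly t x - z \<in> ?J" .
    have "poly t x = a' ^ k * poly (smult (?a ^ k) p - s * f) x" by (simp add: e t_def)
    also have "\<dots> = (?a * a') ^ k * y - a' ^ k * (poly s x * poly f x)"
      by (simp add: y algebra_simps)
    finally have "y - poly t x = a' ^ k * (poly s x * poly f x) - ((?a * a') ^ k - 1) * y"
      by (simp add: algebra_simps)
    also have "\<dots> \<in> ?J"
      using power_cong_one[OF A I, of "?a * a'" k] inv aA sA B(2) that s
      by (intro sJ(2) sJ(3)[of "a'^k"] sJ(4)[of _ y] iJ) auto
    finally have "(y - poly t x) + (poly t x - z) \<in> ?J" using 1 by (rule sJ(6))
    then have "y - z \<in> ?J" by simp
    then show ?thesis using zR by (rule bexI)
  qed
  show ?thesis unfolding finite_index_def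
    by (intro exI[of _ R] conjI ballI Rfin RB cover)
qed

text \<open>
  Let \<open>f\<close> be a polynomial of least degree killing \<open>x\<close>, with leading coefficient \<open>a\<close>.  A nonzero
  \<open>b \<in> A[x]\<close> divides some nonzero constant \<open>d \<in> A\<close>: take a polynomial of least degree whose value at
  \<open>x\<close> is a nonzero multiple of \<open>b\<close>; were its degree positive, dividing \<open>f\<close> by it would contradict one
  of the two minimality choices.  An ideal \<open>I\<close> modulo which \<open>a d\<close> is a unit generates an ideal of
  \<open>A[x]\<close> that has finite index because \<open>a\<close> is a unit modulo it, and that is proper because
  \<open>1, x, x\<^sup>2, \<dots>\<close> below the degree of \<open>f\<close> are linearly independent over \<open>A\<close>.
\<close>

lemma residually_invertible_adjoin_algebraic:
  fixes x :: "'a::idom"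
  assumes A: "subring_of A" and RI: "residually_invertible A"
    and alg: "\<exists>f\<in>polys_over A. f \<noteq> 0 \<and> poly f x = 0"
  shows "residually_invertible (adjoin A x)"
  unfolding residually_invertible_def
proof (intro ballI impI)
  fix b assume b: "b \<in> adjoin A x" "b \<noteq> 0"
  note S = ideal_of_self[OF A] and sA = subring_of_simps[OF A]
  note B = adjoin_subring[OF A, of x]
  note c = polys_over_simps[OF S] polys_over_mult[OF S]
  obtain f where f: "f \<in> polys_over A" "f \<noteq> 0" "poly f x = 0"
    and f_min: "\<And>g. g \<in> polys_over A \<Longrightarrow> g \<noteq> 0 \<Longrightarrow> poly g x = 0 \<Longrightarrow> degree f \<le> degree g"
    using ex_has_least_nat[of "\<lambda>f. f \<in> polys_over A \<and> f \<noteq> 0 \<and> poly f x = 0" _ degree] alg by blast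
  have small: "r = 0" if "r \<in> polys_over A" "poly r x = 0" "r = 0 \<or> degree r < degree f" for r
    using f_min[of r] that by force
  have f0: "degree f > 0" using f by (auto elim!: degree_eq_zeroE intro!: Nat.gr0I)
  let ?a = "lead_coeff f"
  have aA: "?a \<in> A" "?a \<noteq> 0" using f by (auto simp: polys_over_def)
  let ?T = "\<lambda>p. p \<in> polys_over A \<and> poly p x \<noteq> 0 \<and> (\<exists>v\<in>adjoin A x. poly p x = b * v)"
  obtain g where g: "g \<in> polys_over A" "b = poly g x" using b by (auto simp: adjoin_def)
  then have "?T g" using b B subring_of_simps(2)[OF B(1)] by (auto intro!: bexI[of _ 1])
  then obtain p where p: "?T p" and p_min: "\<And>q. ?T q \<Longrightarrow> degree p \<le> degree q"
    using ex_has_least_nat[of ?T _ degree] by blast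
  have p0: "p \<noteq> 0" using p by auto
  \<comment> \<open>Minimality forces \<open>p\<close> to be constant: divide \<open>f\<close> by \<open>p\<close> and evaluate at \<open>x\<close>.\<close>
  have "degree p = 0"
  proof (rule ccontr)
    assume dp: "degree p \<noteq> 0"
    obtain v where v: "v \<in> adjoin A x" "poly p x = b * v" using p by blast
    obtain k s r where k: "s \<in> polys_over A" "r \<in> polys_over A" "r = 0 \<or> degree r < degree f"
      and e: "smult (?a ^ k) p = s * f + r"
      using pseudo_division[OF A S f(1,2), of p] p by blast
    have "poly r x = poly (smult (?a ^ k) p) x" using f(3) by (simp add: e)
    then have "poly r x = b * (?a ^ k * v)" "poly r x \<noteq> 0" using v aA p by simp_all
    then have "?T r" using k v sA(7)[OF aA(1)] B(2) subring_of_simps(4)[OF B(1)] by blast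
    then have pf: "degree p < degree f" using k(3) p_min[of r] by auto
    let ?l = "lead_coeff p"
    have lA: "?l \<in> A" "?l \<noteq> 0" using p p0 by (auto simp: polys_over_def)
    obtain k' s' r' where k': "s' \<in> polys_over A" "r' \<in> polys_over A" "r' = 0 \<or> degree r' < degree p"
      and e': "smult (?l ^ k') f = s' * p + r'"
      using pseudo_division[OF A S _ p0 f(1)] p by blast
    have "poly (s' * p + r') x = 0" unfolding e'[symmetric] using f(3) by simp
    then have r's': "poly r' x = - poly s' x * poly p x" by (simp add: algebra_simps add_eq_0_iff)
    then have "poly r' x = b * (- poly s' x * v)" using v by (simp add: algebra_simps)
    moreover have "- poly s' x * v \<in> adjoin A x"
      by (intro subring_of_simps(4,5)[OF B(1)] adjoin_intro k' v)
    ultimately have "?T r'" if "poly r' x \<noteq> 0" using k'(2) that by blast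
    then have "poly r' x = 0"
      using k'(3) p_min[of r'] by (cases "r' = 0") auto
    then have "r' = 0" using small k' pf by auto
    then have s'x: "poly s' x = 0" using r's' p by auto
    have s'p: "s' * p = smult (?l ^ k') f" using e' \<open>r' = 0\<close> by simp
    then have "s' \<noteq> 0" using lA f by auto
    have "degree s' + degree p = degree f"
      using arg_cong[OF s'p, of degree] \<open>s' \<noteq> 0\<close> p0 lA by (simp add: degree_mult_eq)
    then show False using f_min[OF k'(1) \<open>s' \<noteq> 0\<close> s'x] dp by simp
  qed
  then obtain d where pd: "p = [:d:]" by (auto elim: degree_eq_zeroE)
  then have d: "d \<in> A" "d \<noteq> 0" using p by (auto simp: polys_over_def split: nat.splits dest: spec[of _ 0])
  obtain v where v: "v \<in> adjoin A x" "d = b * v" using p pd by auto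
  have "?a * d \<in> A" "?a * d \<noteq> 0" using aA d sA by auto
  then obtain I w where I: "ideal_of A I" "1 \<notin> I" "finite_index A I" and w: "w \<in> A" "?a * d * w - 1 \<in> I"
    using RI unfolding residually_invertible_def by meson
  let ?J = "adjoin_ideal A I f x"
  note J = adjoin_ideal_is_ideal[OF A I(1) f(1), of x]
  note iJ = adjoin_ideal_intros[OF A I(1)]
  have a': "d * w \<in> A" "?a * (d * w) - 1 \<in> I" using d w sA by (auto simp: mult.assoc)
  have fin: "finite_index (adjoin A x) ?J"
    by (rule adjoin_ideal_finite_index[OF A I(1) f(1,2) I(3) a'])
  have "1 \<notin> ?J"
  proof
    assume "1 \<in> ?J"
    then obtain q where q: "q \<in> polys_over I" "poly q x = 1"
      using f(3) by (auto simp: adjoin_ideal_def)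
    obtain k s r where r: "r \<in> polys_over I" "r = 0 \<or> degree r < degree f"
      and e: "smult (?a ^ k) q = s * f + r"
      using pseudo_division[OF A I(1) f(1,2) q(1)] by blast
    have "poly r x = poly (smult (?a ^ k) q) x" using f(3) by (simp add: e)
    then have rx: "poly r x = ?a ^ k" using q by simp
    have rA: "r \<in> polys_over A" using r ideal_of_simps(7)[OF I(1)] by (auto simp: polys_over_def)
    have akA: "?a ^ k \<in> A" using sA(7) aA by auto
    have "r - [:?a ^ k:] = 0"
    proof (rule small)
      show "r - [:?a ^ k:] \<in> polys_over A" using akA by (intro c rA)
      show "poly (r - [:?a ^ k:]) x = 0" using rx by simp
      have "degree (r - [:?a ^ k:]) < degree f"
        using r(2) f0 by (intro degree_diff_less) auto
      then show "r - [:?a ^ k:] = 0 \<or> degree (r - [:?a ^ k:]) < degree f" ..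
    qed
    then have "?a ^ k \<in> I" using r(1) by (auto simp: polys_over_def coeff_pCons dest!: spec[of _ 0])
    then have "(?a * (d * w)) ^ k \<in> I"
      using ideal_of_simps(4)[OF I(1)] sA(7)[OF a'(1)] by (simp add: power_mult_distrib)
    moreover have "(?a * (d * w)) ^ k - 1 \<in> I"
      using power_cong_one[OF A I(1) _ a'(2)] aA(1) a' sA by blast
    ultimately have "(?a * (d * w)) ^ k - ((?a * (d * w)) ^ k - 1) \<in> I"
      by (rule ideal_of_simps(2)[OF I(1)])
    then show False using I(2) by simp
  qed
  moreover have "b * (v * (?a * w)) - 1 \<in> ?J"
    using iJ(3)[OF w(2)] v(2) by (simp add: mult_ac)
  moreover have "v * (?a * w) \<in> adjoin A x"
    using v B(2) aA w subring_of_simps(4)[OF B(1)] by blast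
  ultimately show "\<exists>J. ideal_of (adjoin A x) J \<and> 1 \<notin> J \<and> finite_index (adjoin A x) J \<and>
      (\<exists>c\<in>adjoin A x. b * c - 1 \<in> J)"
    using J fin by blast
qed

text \<open>
  For \<open>b = g(x)\<close>, choose \<open>I\<close> so that the leading coefficient of \<open>g\<close> is a unit modulo \<open>I\<close>, and
  adjoin the relation \<open>b x = 1\<close>, that is \<open>f = X g - 1\<close>.  This makes \<open>x\<close> an inverse of \<open>b\<close>.  The
  resulting ideal is proper since \<open>f\<close> has positive degree and a unit as leading coefficient modulo
  \<open>I\<close>, so no nonzero multiple of it is constant modulo \<open>I\<close>.
\<close>

lemma residually_invertible_adjoin_transcendental:
  fixes x :: "'a::idom"
  assumes A: "subring_of A" and RI: "residually_invertible A"
    and tr: "\<And>f. f \<in> polys_over A \<Longrightarrow> poly f x = 0 \<Longrightarrow> f = 0"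
  shows "residually_invertible (adjoin A x)"
  unfolding residually_invertible_def
proof (intro ballI impI)
  fix b assume b: "b \<in> adjoin A x" "b \<noteq> 0"
  note S = ideal_of_self[OF A] and sA = subring_of_simps[OF A]
  note B = adjoin_subring[OF A, of x]
  note c = polys_over_simps[OF S] polys_over_mult[OF S]
  obtain g where g: "g \<in> polys_over A" "b = poly g x" using b by (auto simp: adjoin_def)
  have g0: "g \<noteq> 0" using b g by auto
  have "lead_coeff g \<in> A" "lead_coeff g \<noteq> 0" using g g0 by (auto simp: polys_over_def)
  then obtain I a' where I: "ideal_of A I" "1 \<notin> I" "finite_index A I"
    and a': "a' \<in> A" "lead_coeff g * a' - 1 \<in> I"
    using RI unfolding residually_invertible_def by meson
  note sI = ideal_of_simps[OF I(1)]
  define f where "f = pCons (-1) g"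
  have lf: "lead_coeff f = lead_coeff g" "degree f = Suc (degree g)" "f \<noteq> 0" using g0 by (simp_all add: f_def)
  have f: "f \<in> polys_over A" unfolding f_def by (intro c g sA)
  let ?J = "adjoin_ideal A I f x"
  note J = adjoin_ideal_is_ideal[OF A I(1) f, of x]
  have fin: "finite_index (adjoin A x) ?J"
    by (rule adjoin_ideal_finite_index[OF A I(1) f lf(3) I(3) a'(1)]) (use a' lf in simp)
  have "1 \<notin> ?J"
  proof
    assume "1 \<in> ?J"
    then obtain q s where q: "q \<in> polys_over I" and s: "s \<in> polys_over A" and e: "poly (q + s * f) x = 1"
      by (auto simp: adjoin_ideal_def)
    have qA: "q \<in> polys_over A" using q sI(7) by (auto simp: polys_over_def)
    have "q + s * f - [:1:] = 0"
      by (rule tr) (use e in \<open>auto simp del: poly_add poly_mult intro!: c qA s f sA\<close>)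
    then have id: "s * f = [:1:] - q" by (simp add: algebra_simps)
    have qi: "coeff q i \<in> I" for i using q by (auto simp: polys_over_def)
    have si: "coeff s i \<in> A" for i using s by (auto simp: polys_over_def)
    have fi: "coeff f i \<in> A" for i using f by (auto simp: polys_over_def)
    \<comment> \<open>\<open>s f\<close> is constant modulo \<open>I\<close>; read off the coefficients of \<open>s\<close> from the top.\<close>
    have sI': "coeff s j \<in> I" for j
    proof (induction "degree s - j" arbitrary: j rule: less_induct)
      case less
      show ?case
      proof (cases "j > degree s")
        case True then show ?thesis using sI(1) by (simp add: coeff_eq_0)
      next
        case False
        let ?n = "j + degree f"
        have "coeff (s * f) ?n = (\<Sum>i\<le>?n. coeff s i * coeff f (?n - i))" by (simp add: coeff_mult)
        also have "\<dots> = coeff s j * lead_coeff g + (\<Sum>i\<in>{..?n} - {j}. coeff s i * coeff f (?n - i))"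
          using lf by (subst sum.remove[of _ j]) auto
        finally have "coeff s j * lead_coeff g =
            - coeff q ?n - (\<Sum>i\<in>{..?n} - {j}. coeff s i * coeff f (?n - i))"
          using lf by (simp add: id coeff_pCons split: nat.splits)
        also have "\<dots> \<in> I"
        proof (intro sI(2) sI(5) qi ideal_of_sum[OF I(1)])
          fix i assume i: "i \<in> {..?n} - {j}"
          show "coeff s i * coeff f (?n - i) \<in> I"
          proof (cases "i < j")
            case True
            then show ?thesis using sI(1) by (simp add: coeff_eq_0)
          next
            case ij: False
            then have "coeff s i \<in> I" using less[of i] i False
              by (cases "i > degree s") (auto simp: coeff_eq_0 sI(1))
            then show ?thesis using fi by (rule sI(4))
          qed
        qed
        finally have 1: "coeff s j * lead_coeff g \<in> I" .
        have "coeff s j = coeff s j * lead_coeff g * a' - coeff s j * (lead_coeff g * a' - 1)"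
          by (simp add: algebra_simps)
        also have "\<dots> \<in> I" by (intro sI(2) sI(4)[OF 1] sI(3) si a')
        finally show ?thesis .
      qed
    qed
    have "1 = coeff (s * f) 0 + coeff q 0" by (simp add: id)
    also have "\<dots> = coeff s 0 * coeff f 0 + coeff q 0" by (simp add: coeff_mult)
    also have "\<dots> \<in> I" by (intro sI(6) sI(4) sI' fi qi)
    finally show False using I(2) by simp
  qed
  moreover have "b * x - 1 \<in> ?J"
    using adjoin_ideal_intros(2)[OF A I(1), of "[:1:]" x f] c(1) sA
    by (simp add: f_def g(2) c mult.commute)
  ultimately show "\<exists>J. ideal_of (adjoin A x) J \<and> 1 \<notin> J \<and> finite_index (adjoin A x) J \<and>
      (\<exists>c\<in>adjoin A x. b * c - 1 \<in> J)"
    using J fin B(3) by blast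
qed

lemma residually_invertible_adjoin:
  fixes x :: "'a::idom"
  assumes "subring_of A" "residually_invertible A"
  shows "residually_invertible (adjoin A x)"
proof (cases "\<exists>f\<in>polys_over A. f \<noteq> 0 \<and> poly f x = 0")
  case True
  then show ?thesis by (rule residually_invertible_adjoin_algebraic[OF assms])
next
  case False
  then show ?thesis by (intro residually_invertible_adjoin_transcendental[OF assms]) blast
qed

text \<open>
  For a nonzero integer any prime exceeding its absolute value will do.
\<close>

lemma residually_invertible_Ints: "residually_invertible (\<int> :: 'a::{idom,ring_char_0} set)"
  unfolding residually_invertible_def
proof (intro ballI impI)
  fix a :: 'a assume "a \<in> \<int>" "a \<noteq> 0"
  from \<open>a \<in> \<int>\<close> obtain z where az: "a = of_int z" by (rule Ints_cases)
  with \<open>a \<noteq> 0\<close> have z: "a = of_int z" "z \<noteq> 0" by auto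
  obtain p :: nat where p: "Factorial_Ring.prime p" "p > nat \<bar>z\<bar>" using bigger_prime by blast
  have "\<not> int p dvd z" using p(2) z(2) dvd_imp_le_int[of z "int p"] by auto
  moreover have "Factorial_Ring.prime (int p)" using p(1) by simp
  ultimately have "coprime (int p) z" by (intro prime_imp_coprime)
  then have "coprime z (int p)" by (simp add: coprime_commute)
  then obtain u v where uv: "u * z + v * int p = 1" using bezout_int[of z "int p"] by auto
  define I where "I = range (\<lambda>k. of_int (k * int p) :: 'a)"
  have "ideal_of \<int> I" unfolding ideal_of_def
  proof (intro conjI ballI)
    show "0 \<in> I" unfolding I_def by (auto intro!: image_eqI[of _ _ 0])
    fix a b assume "a \<in> I" "b \<in> I"
    then obtain k l where "a = of_int (k * int p)" "b = of_int (l * int p)" by (auto simp: I_def)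
    then have "a - b = of_int ((k - l) * int p)" by (simp add: algebra_simps)
    then show "a - b \<in> I" unfolding I_def by blast
  next
    fix a b :: 'a assume "a \<in> \<int>" "b \<in> I"
    then obtain k l where "a = of_int k" "b = of_int (l * int p)" unfolding I_def by (blast elim: Ints_cases)
    then have "a * b = of_int ((k * l) * int p)" by (simp add: algebra_simps)
    then show "a * b \<in> I" unfolding I_def by blast
  qed (auto simp: I_def)
  moreover have "1 \<notin> I"
  proof
    assume "1 \<in> I"
    then obtain k where "(of_int 1 :: 'a) = of_int (k * int p)" by (auto simp: I_def)
    then have "1 = k * int p" unfolding of_int_eq_iff .
    then have "int p dvd 1" by (metis dvd_triv_right)
    then show False using p(1) by (simp add: prime_nat_iff)
  qed
  moreover have "finite_index \<int> I" unfolding finite_index_def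
  proof (intro exI[of _ "of_int ` {0..<int p}"] conjI ballI)
    fix a :: 'a assume "a \<in> \<int>"
    then obtain k where k: "a = of_int k" by (rule Ints_cases)
    have "a - of_int (k mod int p) = of_int (k div int p * int p)"
      by (simp add: k minus_mod_eq_div_mult flip: of_int_diff)
    then have "a - of_int (k mod int p) \<in> I" unfolding I_def by blast
    moreover have "k mod int p \<in> {0..<int p}" using p by (simp add: prime_gt_0_nat)
    ultimately show "\<exists>f\<in>of_int ` {0..<int p}. a - f \<in> I" by blast
  qed auto
  moreover have "a * of_int u - 1 \<in> I"
  proof -
    have "a * of_int u - 1 = of_int ((- v) * int p)"
      using arg_cong[OF uv, of "of_int :: _ \<Rightarrow> 'a"] by (simp add: z algebra_simps)
    then show ?thesis unfolding I_def by blast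
  qed
  ultimately show "\<exists>I. ideal_of \<int> I \<and> 1 \<notin> I \<and> finite_index \<int> I \<and> (\<exists>b\<in>\<int>. a * b - 1 \<in> I)"
    by (meson Ints_of_int)
qed

text \<open>
  A finite set is contained in the subring that it generates over \<open>\<int>\<close>, which is built by adjoining
  its elements successively.
\<close>

lemma finite_subset_residually_invertible_subring:
  fixes S :: "'a::{idom,ring_char_0} set"
  assumes "finite S"
  obtains A where "subring_of A" "S \<subseteq> A" "residually_invertible A"
proof -
  have "\<exists>A. subring_of A \<and> S \<subseteq> A \<and> residually_invertible A"
    using assms
  proof (induction S)
    case empty
    have "subring_of (\<int> :: 'a set)" by (auto simp: subring_of_def)
    then show ?case using residually_invertible_Ints by blast
  next
    case (insert x S)
    then obtain A where "subring_of A" "S \<subseteq> A" "residually_invertible A" by blast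
    then show ?case
      using adjoin_subring[of A x] residually_invertible_adjoin[of A x]
      by (intro exI[of _ "adjoin A x"]) auto
  qed
  then show thesis using that by blast
qed

section \<open>Residual finiteness of finitely generated unitary groups\<close>

lemma unitary_group_simps [simp]:
  "x \<otimes>\<^bsub>unitary_group n\<^esub> y = x * y" "\<one>\<^bsub>unitary_group n\<^esub> = 1\<^sub>m n"
  by (simp_all add: unitary_group_def)

lemma unitary_carrier_mat: "U \<in> carrier (unitary_group n) \<Longrightarrow> U \<in> carrier_mat n n"
  by (simp add: unitary_group_def)

lemma mat_mult_entry:
  assumes "A \<in> carrier_mat n m" "B \<in> carrier_mat m k" "i < n" "j < k"
  shows "(A * B) $$ (i, j) = (\<Sum>l<m. A $$ (i, l) * B $$ (l, j))"
  using assms by (simp add: scalar_prod_def atLeast0LessThan)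

definition entries_cong :: "nat \<Rightarrow> 'a::comm_ring_1 set \<Rightarrow> 'a mat \<Rightarrow> 'a mat \<Rightarrow> bool" where
  "entries_cong n I M L \<longleftrightarrow> (\<forall>i<n. \<forall>j<n. M $$ (i, j) - L $$ (i, j) \<in> I)"

text \<open>
  Malcev's argument.  The entries of all \<open>\<psi>(g)\<close> lie in a subring \<open>A\<close> as above, because the entries of
  finitely many generators and their inverses do.  If some entry \<open>a\<close> of \<open>\<psi>(J) - 1\<close> is nonzero, reduce
  all matrices modulo an ideal \<open>I\<close> of finite index that avoids \<open>a\<close>.  The elements with
  \<open>\<psi>(g)\<close> congruent to \<open>1\<close> form a normal subgroup \<open>N\<close> of finite index (the congruence subgroup) that
  does not contain \<open>J\<close>.
\<close>

lemma hom_unitary_ker_RF: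
  assumes fg: "finitely_generated_group \<Gamma>" and \<psi>: "\<psi> \<in> hom \<Gamma> (unitary_group n)"
    and J: "J \<in> ker_RF \<Gamma>"
  shows "\<psi> J = 1\<^sub>m n"
proof (rule ccontr)
  assume ne: "\<psi> J \<noteq> 1\<^sub>m n"
  interpret group \<Gamma> using fg by (simp add: finitely_generated_group_def)
  obtain S where S: "finite S" "S \<subseteq> carrier \<Gamma>" "generate \<Gamma> S = carrier \<Gamma>"
    using fg by (auto simp: finitely_generated_group_def)
  have JC: "J \<in> carrier \<Gamma>" using J by (simp add: ker_RF_def)
  have \<psi>c: "\<psi> g \<in> carrier_mat n n" if "g \<in> carrier \<Gamma>" for g
    using \<psi> that by (auto simp: hom_def intro: unitary_carrier_mat)
  have \<psi>u: "mat_adjoint (\<psi> g) * \<psi> g = 1\<^sub>m n" if "g \<in> carrier \<Gamma>" for g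
    using \<psi> that by (auto simp: hom_def unitary_group_def)
  have \<psi>m: "\<psi> (g \<otimes>\<^bsub>\<Gamma>\<^esub> h) = \<psi> g * \<psi> h" if "g \<in> carrier \<Gamma>" "h \<in> carrier \<Gamma>" for g h
    using \<psi> that by (simp add: hom_def)
  have \<psi>1: "\<psi> \<one>\<^bsub>\<Gamma>\<^esub> = 1\<^sub>m n"
  proof -
    let ?U = "\<psi> \<one>\<^bsub>\<Gamma>\<^esub>"
    have c: "?U \<in> carrier_mat n n" "mat_adjoint ?U \<in> carrier_mat n n"
      using \<psi>c mat_adjoint_carrier by auto
    have "?U * ?U = ?U" using \<psi>m[of "\<one>\<^bsub>\<Gamma>\<^esub>" "\<one>\<^bsub>\<Gamma>\<^esub>"] by simp
    then have "mat_adjoint ?U * ?U * ?U = mat_adjoint ?U * ?U"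
      using c by (simp add: assoc_mult_mat[of _ n n _ n _ n])
    then show ?thesis using c by (simp add: \<psi>u)
  qed
  have \<psi>i: "\<psi> g * \<psi> (inv\<^bsub>\<Gamma>\<^esub> g) = 1\<^sub>m n" "\<psi> (inv\<^bsub>\<Gamma>\<^esub> g) * \<psi> g = 1\<^sub>m n" if "g \<in> carrier \<Gamma>" for g
    using that \<psi>m[of g "inv\<^bsub>\<Gamma>\<^esub> g"] \<psi>m[of "inv\<^bsub>\<Gamma>\<^esub> g" g] \<psi>1 by simp_all
  define E where "E = (\<lambda>(g, i, j). \<psi> g $$ (i, j)) ` ((S \<union> m_inv \<Gamma> ` S) \<times> {..<n} \<times> {..<n})"
  have "finite E" using S by (simp add: E_def)
  then obtain A where A: "subring_of A" "E \<subseteq> A" "residually_invertible A"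
    by (rule finite_subset_residually_invertible_subring)
  note sA = subring_of_simps[OF A(1)]
  have entry: "\<psi> g $$ (i, j) \<in> A" if "g \<in> carrier \<Gamma>" "i < n" "j < n" for g i j
  proof -
    from that(1) have "g \<in> generate \<Gamma> S" using S(3) by simp
    then show ?thesis using that(2,3)
    proof (induction arbitrary: i j rule: generate.induct)
      case one
      then show ?case by (simp add: \<psi>1 sA)
    next
      case (incl h)
      then show ?case using A(2) by (auto simp: E_def)
    next
      case (inv h)
      then show ?case using A(2) by (auto simp: E_def)
    next
      case (eng h1 h2)
      have h: "h1 \<in> carrier \<Gamma>" "h2 \<in> carrier \<Gamma>" using eng.hyps S(3) by auto
      have "\<psi> (h1 \<otimes>\<^bsub>\<Gamma>\<^esub> h2) $$ (i, j) = (\<Sum>l<n. \<psi> h1 $$ (i, l) * \<psi> h2 $$ (l, j))"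
        unfolding \<psi>m[OF h] by (rule mat_mult_entry[OF \<psi>c[OF h(1)] \<psi>c[OF h(2)] eng.prems])
      also have "\<dots> \<in> A"
        by (intro ideal_of_sum[OF ideal_of_self[OF A(1)]] sA(4) eng.IH eng.prems) auto
      finally show ?case .
    qed
  qed
  obtain i0 j0 where ij: "i0 < n" "j0 < n" "\<psi> J $$ (i0, j0) \<noteq> 1\<^sub>m n $$ (i0, j0)"
  proof -
    have "\<exists>i j. i < n \<and> j < n \<and> \<psi> J $$ (i, j) \<noteq> 1\<^sub>m n $$ (i, j)"
    proof (rule ccontr)
      assume "\<not> ?thesis"
      then have "\<psi> J = 1\<^sub>m n" using \<psi>c[OF JC] by (intro eq_matI) auto
      with ne show False ..
    qed
    then show thesis using that by blast
  qed
  have one_entry: "1\<^sub>m n $$ (i, j) \<in> A" if "i < n" "j < n" for i j using that by (simp add: sA)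
  define a where "a = \<psi> J $$ (i0, j0) - 1\<^sub>m n $$ (i0, j0)"
  have "a \<in> A" "a \<noteq> 0" unfolding a_def using ij sA(3)[OF entry[OF JC ij(1,2)] one_entry[OF ij(1,2)]] by simp_all
  then obtain I b where I: "ideal_of A I" "1 \<notin> I" "finite_index A I" and b: "b \<in> A" "a * b - 1 \<in> I"
    using A(3) unfolding residually_invertible_def by meson
  note sI = ideal_of_simps[OF I(1)]
  note cg_def = entries_cong_def
  let ?cg = "entries_cong n I"
  define R where "R = {M \<in> carrier_mat n n. \<forall>i<n. \<forall>j<n. M $$ (i, j) \<in> A}"
  have R\<psi>: "\<psi> g \<in> R" if "g \<in> carrier \<Gamma>" for g using entry \<psi>c that by (auto simp: R_def)
  have R1: "1\<^sub>m n \<in> R" using one_entry by (auto simp: R_def)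
  have cg_trans: "?cg M Z" if "?cg M L" "?cg L Z" for M L Z
    unfolding cg_def
  proof (intro allI impI)
    fix i j assume "i < n" "j < n"
    then have "(M $$ (i, j) - L $$ (i, j)) + (L $$ (i, j) - Z $$ (i, j)) \<in> I"
      using that by (intro sI(6)) (auto simp: cg_def)
    then show "M $$ (i, j) - Z $$ (i, j) \<in> I" by simp
  qed
  have cg_left: "?cg (Z * M) (Z * L)" if "?cg M L" "M \<in> R" "L \<in> R" "Z \<in> R" for M L Z
    unfolding cg_def
  proof (intro allI impI)
    fix i j assume "i < n" "j < n"
    then have "(Z * M) $$ (i, j) - (Z * L) $$ (i, j)
        = (\<Sum>l<n. Z $$ (i, l) * (M $$ (l, j) - L $$ (l, j)))"
      using that by (simp add: mat_mult_entry[of _ n n _ n] R_def sum_subtractf right_diff_distrib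
          del: index_mult_mat)
    also have "\<dots> \<in> I"
      using that \<open>i < n\<close> \<open>j < n\<close> by (intro ideal_of_sum[OF I(1)] sI(3)) (auto simp: cg_def R_def)
    finally show "(Z * M) $$ (i, j) - (Z * L) $$ (i, j) \<in> I" .
  qed
  have cg_right: "?cg (M * Z) (L * Z)" if "?cg M L" "M \<in> R" "L \<in> R" "Z \<in> R" for M L Z
    unfolding cg_def
  proof (intro allI impI)
    fix i j assume "i < n" "j < n"
    then have "(M * Z) $$ (i, j) - (L * Z) $$ (i, j)
        = (\<Sum>l<n. (M $$ (i, l) - L $$ (i, l)) * Z $$ (l, j))"
      using that by (simp add: mat_mult_entry[of _ n n _ n] R_def sum_subtractf left_diff_distrib
          del: index_mult_mat)
    also have "\<dots> \<in> I"
      using that \<open>i < n\<close> \<open>j < n\<close> by (intro ideal_of_sum[OF I(1)] sI(4)) (auto simp: cg_def R_def)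
    finally show "(M * Z) $$ (i, j) - (L * Z) $$ (i, j) \<in> I" .
  qed
  define N where "N = {g \<in> carrier \<Gamma>. ?cg (\<psi> g) (1\<^sub>m n)}"
  have cg_sym: "?cg L M" if "?cg M L" for M L
    unfolding cg_def
  proof (intro allI impI)
    fix i j assume "i < n" "j < n"
    then have "- (M $$ (i, j) - L $$ (i, j)) \<in> I" using that by (intro sI(5)) (auto simp: cg_def)
    then show "L $$ (i, j) - M $$ (i, j) \<in> I" by simp
  qed
  have sub: "subgroup N \<Gamma>"
  proof (rule subgroupI)
    show "N \<subseteq> carrier \<Gamma>" by (auto simp: N_def)
    have "\<one>\<^bsub>\<Gamma>\<^esub> \<in> N" by (auto simp: N_def \<psi>1 cg_def sI(1))
    then show "N \<noteq> {}" by blast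
    fix g assume g: "g \<in> N"
    then have gc: "g \<in> carrier \<Gamma>" by (simp add: N_def)
    then have "?cg (\<psi> (inv\<^bsub>\<Gamma>\<^esub> g) * \<psi> g) (\<psi> (inv\<^bsub>\<Gamma>\<^esub> g) * 1\<^sub>m n)"
      using g by (intro cg_left R\<psi> R1) (auto simp: N_def)
    then have "?cg (1\<^sub>m n) (\<psi> (inv\<^bsub>\<Gamma>\<^esub> g))"
      using \<psi>i(2)[OF gc] \<psi>c[OF inv_closed[OF gc]] by simp
    then show "inv\<^bsub>\<Gamma>\<^esub> g \<in> N" using gc by (auto simp: N_def intro: cg_sym)
    fix h assume h: "h \<in> N"
    then have hc: "h \<in> carrier \<Gamma>" by (simp add: N_def)
    have "?cg (\<psi> g * \<psi> h) (\<psi> g * 1\<^sub>m n)"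
      using h gc by (intro cg_left R\<psi> R1) (auto simp: N_def)
    then have "?cg (\<psi> g * \<psi> h) (\<psi> g)" using \<psi>c[OF gc] by simp
    then have "?cg (\<psi> (g \<otimes>\<^bsub>\<Gamma>\<^esub> h)) (1\<^sub>m n)" unfolding \<psi>m[OF gc hc] by (rule cg_trans) (use g in \<open>simp add: N_def\<close>)
    then show "g \<otimes>\<^bsub>\<Gamma>\<^esub> h \<in> N" using gc hc by (simp add: N_def)
  qed
  have normal: "N \<lhd> \<Gamma>"
    unfolding normal_inv_iff
  proof (intro conjI ballI sub)
    fix x h assume x: "x \<in> carrier \<Gamma>" and "h \<in> N"
    then have h: "h \<in> carrier \<Gamma>" "?cg (\<psi> h) (1\<^sub>m n)" by (auto simp: N_def)
    have "?cg (\<psi> x * \<psi> h) (\<psi> x * 1\<^sub>m n)" by (intro cg_left R\<psi> R1 h x)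
    then have "?cg (\<psi> (x \<otimes>\<^bsub>\<Gamma>\<^esub> h)) (\<psi> x)" using \<psi>c[OF x] by (simp add: \<psi>m x h)
    then have "?cg (\<psi> (x \<otimes>\<^bsub>\<Gamma>\<^esub> h) * \<psi> (inv\<^bsub>\<Gamma>\<^esub> x)) (\<psi> x * \<psi> (inv\<^bsub>\<Gamma>\<^esub> x))"
      by (intro cg_right R\<psi> m_closed inv_closed h x)
    then have "?cg (\<psi> (x \<otimes>\<^bsub>\<Gamma>\<^esub> h \<otimes>\<^bsub>\<Gamma>\<^esub> inv\<^bsub>\<Gamma>\<^esub> x)) (1\<^sub>m n)"
      using \<psi>m[of "x \<otimes>\<^bsub>\<Gamma>\<^esub> h" "inv\<^bsub>\<Gamma>\<^esub> x"] \<psi>i(1)[OF x] x h by simp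
    then show "x \<otimes>\<^bsub>\<Gamma>\<^esub> h \<otimes>\<^bsub>\<Gamma>\<^esub> inv\<^bsub>\<Gamma>\<^esub> x \<in> N" using x h by (simp add: N_def)
  qed
  have coset: "N #>\<^bsub>\<Gamma>\<^esub> h = N #>\<^bsub>\<Gamma>\<^esub> g"
    if gh: "g \<in> carrier \<Gamma>" "h \<in> carrier \<Gamma>" "?cg (\<psi> g) (\<psi> h)" for g h
  proof -
    have "?cg (\<psi> g * \<psi> (inv\<^bsub>\<Gamma>\<^esub> h)) (\<psi> h * \<psi> (inv\<^bsub>\<Gamma>\<^esub> h))"
      by (intro cg_right R\<psi> gh inv_closed)
    then have "g \<otimes>\<^bsub>\<Gamma>\<^esub> inv\<^bsub>\<Gamma>\<^esub> h \<in> N"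
      using gh \<psi>m[of g "inv\<^bsub>\<Gamma>\<^esub> h"] \<psi>i(1)[of h] by (simp add: N_def)
    then have "(g \<otimes>\<^bsub>\<Gamma>\<^esub> inv\<^bsub>\<Gamma>\<^esub> h) \<otimes>\<^bsub>\<Gamma>\<^esub> h \<in> N #>\<^bsub>\<Gamma>\<^esub> h" by (auto simp: r_coset_def)
    then have "g \<in> N #>\<^bsub>\<Gamma>\<^esub> h" using gh by (simp add: m_assoc)
    then show ?thesis using gh(2) sub by (rule repr_independence)
  qed
  obtain F where F: "finite F" "F \<subseteq> A" "\<And>a. a \<in> A \<Longrightarrow> \<exists>f\<in>F. a - f \<in> I"
    using I(3) unfolding finite_index_def by metis
  define rep where "rep a = (SOME f. f \<in> F \<and> a - f \<in> I)" for a
  have rep: "rep a \<in> F" "a - rep a \<in> I" if "a \<in> A" for a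
    using F(3)[OF that] unfolding rep_def by (metis (mono_tags, lifting) someI)+
  \<comment> \<open>\<open>red g\<close> is the matrix of the chosen residues of \<open>\<psi> g\<close>; it takes finitely many values and
    determines the coset of \<open>g\<close>.\<close>
  define red where "red g = restrict (\<lambda>(i, j). rep (\<psi> g $$ (i, j))) ({..<n} \<times> {..<n})" for g
  have cg_red: "?cg (\<psi> g) (\<psi> h)" if "g \<in> carrier \<Gamma>" "h \<in> carrier \<Gamma>" "red g = red h" for g h
    unfolding cg_def
  proof (intro allI impI)
    fix i j assume ij: "i < n" "j < n"
    have "rep (\<psi> g $$ (i, j)) = rep (\<psi> h $$ (i, j))"
      using fun_cong[OF that(3), of "(i, j)"] ij by (simp add: red_def)
    then have "(\<psi> g $$ (i, j) - rep (\<psi> g $$ (i, j))) - (\<psi> h $$ (i, j) - rep (\<psi> h $$ (i, j)))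
        = \<psi> g $$ (i, j) - \<psi> h $$ (i, j)" by simp
    moreover have "(\<psi> g $$ (i, j) - rep (\<psi> g $$ (i, j))) - (\<psi> h $$ (i, j) - rep (\<psi> h $$ (i, j))) \<in> I"
      by (intro sI(2) rep entry that ij)
    ultimately show "\<psi> g $$ (i, j) - \<psi> h $$ (i, j) \<in> I" by (simp only:)
  qed
  have "red ` carrier \<Gamma> \<subseteq> ({..<n} \<times> {..<n}) \<rightarrow>\<^sub>E F"
  proof (rule image_subsetI)
    fix g assume "g \<in> carrier \<Gamma>"
    then show "red g \<in> ({..<n} \<times> {..<n}) \<rightarrow>\<^sub>E F"
      unfolding red_def restrict_PiE_iff by (auto intro!: rep entry)
  qed
  then have fin: "finite (red ` carrier \<Gamma>)"
    by (rule finite_subset) (intro finite_PiE, use F in auto)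
  have "(\<lambda>g. N #>\<^bsub>\<Gamma>\<^esub> g) ` carrier \<Gamma>
      \<subseteq> (\<lambda>r. N #>\<^bsub>\<Gamma>\<^esub> (SOME g. g \<in> carrier \<Gamma> \<and> red g = r)) ` red ` carrier \<Gamma>"
  proof (rule image_subsetI)
    fix g assume g: "g \<in> carrier \<Gamma>"
    let ?h = "SOME h. h \<in> carrier \<Gamma> \<and> red h = red g"
    have h: "?h \<in> carrier \<Gamma> \<and> red ?h = red g" by (rule someI[of _ g]) (use g in simp)
    have "N #>\<^bsub>\<Gamma>\<^esub> g = N #>\<^bsub>\<Gamma>\<^esub> ?h" using h g by (intro coset cg_red) auto
    then show "N #>\<^bsub>\<Gamma>\<^esub> g \<in> (\<lambda>r. N #>\<^bsub>\<Gamma>\<^esub> (SOME g. g \<in> carrier \<Gamma> \<and> red g = r)) ` red ` carrier \<Gamma>"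
      using g by (intro image_eqI[of _ _ "red g"]) auto
  qed
  then have "finite ((\<lambda>g. N #>\<^bsub>\<Gamma>\<^esub> g) ` carrier \<Gamma>)" using fin by (meson finite_imageI finite_subset)
  moreover have "carrier (\<Gamma> Mod N) = (\<lambda>g. N #>\<^bsub>\<Gamma>\<^esub> g) ` carrier \<Gamma>"
    by (auto simp: FactGroup_def RCOSETS_def)
  ultimately have "N #>\<^bsub>\<Gamma>\<^esub> J = \<one>\<^bsub>\<Gamma> Mod N\<^esub>" using J normal by (simp add: ker_RF_def)
  then have "N #>\<^bsub>\<Gamma>\<^esub> J = N" by (simp add: FactGroup_def)
  then have "J \<in> N" using rcos_self[OF JC sub] by simp
  then have "a \<in> I" using ij by (simp add: N_def cg_def a_def)
  then have "a * b - (a * b - 1) \<in> I" by (intro sI(2) b sI(4))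
  then show False using I(2) by simp
qed

section \<open>Diagonalization of unitary matrices\<close>

lemma mat_adjoint_dim [simp]:
  "dim_row (mat_adjoint A) = dim_col A" "dim_col (mat_adjoint A) = dim_row A"
  by (simp_all add: mat_adjoint_def)

lemma mat_adjoint_entry:
  fixes A :: "complex mat"
  assumes "i < dim_col A" "j < dim_row A"
  shows "mat_adjoint A $$ (i, j) = cnj (A $$ (j, i))"
  using assms by (simp add: mat_adjoint_def mat_of_rows_def)

lemma mat_adjoint_mult:
  fixes A B :: "complex mat"
  assumes A: "A \<in> carrier_mat n m" and B: "B \<in> carrier_mat m k"
  shows "mat_adjoint (A * B) = mat_adjoint B * mat_adjoint A"
proof (rule eq_matI)
  fix i j assume "i < dim_row (mat_adjoint B * mat_adjoint A)" "j < dim_col (mat_adjoint B * mat_adjoint A)"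
  then have ij: "i < k" "j < n" using A B by auto
  have "mat_adjoint (A * B) $$ (i, j) = cnj (\<Sum>l<m. A $$ (j, l) * B $$ (l, i))"
    using A B ij by (subst mat_adjoint_entry) (auto simp: mat_mult_entry[OF A B] simp del: index_mult_mat(1))
  also have "\<dots> = (\<Sum>l<m. mat_adjoint B $$ (i, l) * mat_adjoint A $$ (l, j))"
    using A B ij by (simp add: mat_adjoint_entry mult.commute)
  also have "\<dots> = (mat_adjoint B * mat_adjoint A) $$ (i, j)"
    by (rule mat_mult_entry[symmetric]) (use A B ij in \<open>auto intro: mat_adjoint_carrier\<close>)
  finally show "mat_adjoint (A * B) $$ (i, j) = (mat_adjoint B * mat_adjoint A) $$ (i, j)" .
qed (use A B in auto)

lemma mat_adjoint_adjoint: "mat_adjoint (mat_adjoint A) = (A :: complex mat)"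
  by (rule eq_matI) (auto simp: mat_adjoint_entry)

lemma mat_adjoint_mat_diag: "mat_adjoint (mat_diag n d) = mat_diag n (\<lambda>i. cnj (d i))"
  by (rule eq_matI) (auto simp: mat_adjoint_entry mat_diag_def)

lemma mat_adjoint_one: "mat_adjoint (1\<^sub>m n) = (1\<^sub>m n :: complex mat)"
  by (rule eq_matI) (auto simp: mat_adjoint_entry)

lemma unitaryI:
  assumes "U \<in> carrier_mat n n" "mat_adjoint U * U = 1\<^sub>m n"
  shows "U \<in> carrier (unitary_group n)"
  using assms mat_mult_left_right_inverse[OF mat_adjoint_carrier[OF assms(1)] assms(1,2)]
  by (simp add: unitary_group_def)

lemma unitaryD:
  assumes "U \<in> carrier (unitary_group n)"
  shows "U \<in> carrier_mat n n" "mat_adjoint U \<in> carrier_mat n n"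
    "mat_adjoint U * U = 1\<^sub>m n" "U * mat_adjoint U = 1\<^sub>m n"
  using assms mat_adjoint_carrier[of U n n] by (auto simp: unitary_group_def)

lemma assoc_mult_square_mat:
  "A \<in> carrier_mat n n \<Longrightarrow> B \<in> carrier_mat n n \<Longrightarrow> C \<in> carrier_mat n n \<Longrightarrow> A * B * C = A * (B * C)"
  by (rule assoc_mult_mat)

lemma unitary_cancel_left:
  assumes U: "U \<in> carrier (unitary_group n)" and A: "A \<in> carrier_mat n n"
  shows "mat_adjoint U * (U * A) = A" "U * (mat_adjoint U * A) = A"
proof -
  note u = unitaryD[OF U]
  have "mat_adjoint U * (U * A) = mat_adjoint U * U * A" by (rule assoc_mult_square_mat[OF u(2,1) A, symmetric])
  then show "mat_adjoint U * (U * A) = A" using u A by simp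
  have "U * (mat_adjoint U * A) = U * mat_adjoint U * A" by (rule assoc_mult_square_mat[OF u(1,2) A, symmetric])
  then show "U * (mat_adjoint U * A) = A" using u A by simp
qed

lemma unitary_one: "1\<^sub>m n \<in> carrier (unitary_group n)"
  by (rule unitaryI) (simp_all add: mat_adjoint_one)

lemma unitary_mult:
  assumes U: "U \<in> carrier (unitary_group n)" and V: "V \<in> carrier (unitary_group n)"
  shows "U * V \<in> carrier (unitary_group n)"
proof (rule unitaryI)
  note u = unitaryD[OF U] and v = unitaryD[OF V]
  show c: "U * V \<in> carrier_mat n n" using u v by auto
  have "mat_adjoint (U * V) * (U * V) = mat_adjoint V * (mat_adjoint U * (U * V))"
    unfolding mat_adjoint_mult[OF u(1) v(1)] by (rule assoc_mult_square_mat[OF v(2) u(2) c])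
  then show "mat_adjoint (U * V) * (U * V) = 1\<^sub>m n"
    by (simp add: unitary_cancel_left[OF U v(1)] v)
qed

lemma unitary_adjoint:
  assumes U: "U \<in> carrier (unitary_group n)"
  shows "mat_adjoint U \<in> carrier (unitary_group n)"
  using unitaryD[OF U] by (intro unitaryI) (simp_all add: mat_adjoint_adjoint)

lemma unitary_sum_cmod:
  assumes U: "U \<in> carrier (unitary_group n)" and i: "i < n"
  shows "(\<Sum>k<n. (cmod (U $$ (k, i)))\<^sup>2) = 1" "(\<Sum>k<n. (cmod (U $$ (i, k)))\<^sup>2) = 1"
proof -
  have *: "(\<Sum>k<n. (cmod (U $$ (k, i)))\<^sup>2) = 1" if U: "U \<in> carrier (unitary_group n)" for U
  proof -
    note u = unitaryD[OF U]
    have "complex_of_real (\<Sum>k<n. (cmod (U $$ (k, i)))\<^sup>2) = (\<Sum>k<n. mat_adjoint U $$ (i, k) * U $$ (k, i))"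
      using u i by (auto simp: mat_adjoint_entry mult.commute simp flip: complex_norm_square intro!: sum.cong)
    also have "\<dots> = (mat_adjoint U * U) $$ (i, i)" by (rule mat_mult_entry[OF u(2,1) i i, symmetric])
    also have "\<dots> = of_real 1" using u(3) i by simp
    finally show ?thesis by (simp only: of_real_eq_iff)
  qed
  show "(\<Sum>k<n. (cmod (U $$ (k, i)))\<^sup>2) = 1" by (rule *[OF U])
  have "(\<Sum>k<n. (cmod (mat_adjoint U $$ (k, i)))\<^sup>2) = 1" by (rule *[OF unitary_adjoint[OF U]])
  then show "(\<Sum>k<n. (cmod (U $$ (i, k)))\<^sup>2) = 1"
    using unitaryD[OF U] i by (simp add: mat_adjoint_entry)
qed

text \<open>
  The block diagonal matrix with blocks \<open>e\<close> and \<open>A\<close>.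
\<close>

definition bordered :: "complex \<Rightarrow> complex mat \<Rightarrow> complex mat" where
  "bordered e A = mat (Suc (dim_row A)) (Suc (dim_col A))
     (\<lambda>(i, j). if i = 0 \<and> j = 0 then e else if i = 0 \<or> j = 0 then 0 else A $$ (i - 1, j - 1))"

lemma bordered_carrier: "A \<in> carrier_mat n n \<Longrightarrow> bordered e A \<in> carrier_mat (Suc n) (Suc n)"
  by (auto simp: bordered_def)

lemma bordered_mult:
  assumes A: "A \<in> carrier_mat n n" and B: "B \<in> carrier_mat n n"
  shows "bordered e A * bordered f B = bordered (e * f) (A * B)"
proof (rule eq_matI)
  note c = bordered_carrier[OF A, of e] bordered_carrier[OF B, of f]
  fix i j assume "i < dim_row (bordered (e * f) (A * B))" "j < dim_col (bordered (e * f) (A * B))"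
  then have ij: "i < Suc n" "j < Suc n" using A B by (auto simp: bordered_def)
  have "(bordered e A * bordered f B) $$ (i, j)
      = (\<Sum>l<Suc n. bordered e A $$ (i, l) * bordered f B $$ (l, j))"
    by (rule mat_mult_entry[OF c ij])
  also have "\<dots> = bordered e A $$ (i, 0) * bordered f B $$ (0, j)
      + (\<Sum>l<n. bordered e A $$ (i, Suc l) * bordered f B $$ (Suc l, j))"
    by (rule sum.lessThan_Suc_shift)
  also have "\<dots> = bordered (e * f) (A * B) $$ (i, j)"
    using A B ij
    by (cases i; cases j) (auto simp: bordered_def mat_mult_entry[OF A B] simp del: index_mult_mat(1))
  finally show "(bordered e A * bordered f B) $$ (i, j) = bordered (e * f) (A * B) $$ (i, j)" .
qed (use A B in \<open>auto simp: bordered_def\<close>)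

lemma bordered_adjoint: "mat_adjoint (bordered e A) = bordered (cnj e) (mat_adjoint A)"
  by (rule eq_matI) (auto simp: mat_adjoint_entry bordered_def)

lemma bordered_mat_diag: "bordered e (mat_diag n d) = mat_diag (Suc n) (case_nat e d)"
  by (rule eq_matI) (auto simp: bordered_def mat_diag_def split: nat.splits)

lemma bordered_one: "bordered 1 (1\<^sub>m n) = 1\<^sub>m (Suc n)"
  by (rule eq_matI) (auto simp: bordered_def)

lemma bordered_inj:
  assumes e: "bordered e A = bordered f B" and A: "A \<in> carrier_mat n n" and B: "B \<in> carrier_mat n n"
  shows "A = B"
proof (rule eq_matI)
  fix i j assume "i < dim_row B" "j < dim_col B"
  then show "A $$ (i, j) = B $$ (i, j)"
    using arg_cong[OF e, of "\<lambda>M. M $$ (Suc i, Suc j)"] A B by (simp add: bordered_def)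
qed (use A B in auto)

lemma scalar_prod_conjugate_self:
  "v \<bullet>c v = complex_of_real (\<Sum>i<dim_vec v. (cmod (v $ i))\<^sup>2)"
  by (auto simp: scalar_prod_def atLeast0LessThan intro!: sum.cong simp flip: complex_norm_square)

text \<open>
  Complete \<open>v\<close> to a basis, orthogonalize by Gram-Schmidt, which keeps the first vector, and normalize.
\<close>

lemma unitary_completion:
  fixes v :: "complex vec"
  assumes v: "v \<in> carrier_vec n" and v0: "v \<noteq> 0\<^sub>v n" and n: "n > 0"
  shows "\<exists>W\<in>carrier (unitary_group n). \<exists>c. \<forall>i<n. W $$ (i, 0) = c * v $ i"
proof -
  interpret cof_vec_space n "TYPE(complex)" .
  note b = basis_completion[OF v v0]
  define ws where "ws = gram_schmidt n (basis_completion v)"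
  have ws: "set ws \<subseteq> carrier_vec n" "corthogonal ws" "length ws = n"
    using gram_schmidt_result[OF b(2,4,5) ws_def] b(6) by auto
  obtain vs where "basis_completion v = v # vs" using b(6,7) n by (cases "basis_completion v") auto
  then have "hd ws = v" using v by (simp add: ws_def)
  then have ws0: "ws ! 0 = v" using ws(3) n by (metis hd_conv_nth length_greater_0_conv)
  have wsc: "ws ! i \<in> carrier_vec n" if "i < n" for i using ws(1,3) that by (meson nth_mem subsetD)
  define r where "r j = sqrt (\<Sum>i<n. (cmod (ws ! j $ i))\<^sup>2)" for j
  have rr: "ws ! j \<bullet>c ws ! j = complex_of_real ((r j)\<^sup>2)" if "j < n" for j
    using wsc[OF that] by (simp add: scalar_prod_conjugate_self r_def sum_nonneg)
  have r0: "r j \<noteq> 0" if "j < n" for j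
    using rr[OF that] corthogonalD[OF ws(2), of j j] that ws(3) by auto
  define W where "W = mat n n (\<lambda>(i, j). ws ! j $ i / complex_of_real (r j))"
  have W: "W \<in> carrier_mat n n" by (simp add: W_def)
  have "mat_adjoint W * W = 1\<^sub>m n"
  proof (rule eq_matI)
    fix i j assume "i < dim_row (1\<^sub>m n :: complex mat)" "j < dim_col (1\<^sub>m n :: complex mat)"
    then have ij: "i < n" "j < n" by auto
    have "(mat_adjoint W * W) $$ (i, j) = (\<Sum>l<n. mat_adjoint W $$ (i, l) * W $$ (l, j))"
      by (rule mat_mult_entry[OF mat_adjoint_carrier[OF W] W ij])
    also have "\<dots> = (\<Sum>l<n. ws ! j $ l * cnj (ws ! i $ l) / (of_real (r i) * of_real (r j)))"
      using W ij by (auto simp: mat_adjoint_entry W_def mult.commute intro!: sum.cong)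
    also have "\<dots> = (ws ! j \<bullet>c ws ! i) / (of_real (r i) * of_real (r j))"
      using wsc[OF ij(1)] wsc[OF ij(2)]
      by (simp add: scalar_prod_def atLeast0LessThan sum_divide_distrib)
    also have "\<dots> = 1\<^sub>m n $$ (i, j)"
      using ij rr[OF ij(1)] r0[OF ij(1)] corthogonalD[OF ws(2), of j i] ws(3)
      by (auto simp: power2_eq_square)
    finally show "(mat_adjoint W * W) $$ (i, j) = 1\<^sub>m n $$ (i, j)" .
  qed (use W in auto)
  then have "W \<in> carrier (unitary_group n)" by (rule unitaryI[OF W])
  moreover have "\<forall>i<n. W $$ (i, 0) = (1 / of_real (r 0)) * v $ i" using n by (auto simp: W_def ws0)
  ultimately show ?thesis by blast
qed

lemma exists_eigenvector:
  fixes A :: "complex mat"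
  assumes A: "A \<in> carrier_mat n n" and n: "n > 0"
  shows "\<exists>v e. v \<in> carrier_vec n \<and> v \<noteq> 0\<^sub>v n \<and> A *\<^sub>v v = e \<cdot>\<^sub>v v"
proof -
  have "degree (char_poly A) = n" using degree_monic_char_poly[OF A] by blast
  then have "\<not> constant (poly (char_poly A))" using n by (simp add: constant_degree)
  then obtain e where "poly (char_poly A) e = 0" using fundamental_theorem_of_algebra by blast
  then have "eigenvalue A e" by (simp add: eigenvalue_root_char_poly[OF A])
  then show ?thesis using A by (auto simp: eigenvalue_def eigenvector_def)
qed

text \<open>
  Conjugate an eigenvector to the first basis vector.  The first column of the resulting unitary matrix
  \<open>T\<close> is then \<open>(e, 0, \<dots>, 0)\<close>; both the first column and the first row of \<open>T\<close> have norm \<open>1\<close>, so the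
  first row vanishes off the diagonal too, and \<open>T\<close> splits off the block \<open>e\<close>.
\<close>

lemma unitary_diagonalization:
  assumes "U \<in> carrier (unitary_group n)"
  shows "\<exists>V\<in>carrier (unitary_group n). \<exists>d. U = V * mat_diag n d * mat_adjoint V"
  using assms
proof (induction n arbitrary: U)
  case 0
  have "U = 1\<^sub>m 0 * mat_diag 0 (\<lambda>_. 0) * mat_adjoint (1\<^sub>m 0)"
    using unitaryD(1)[OF 0] by (intro eq_matI) (auto simp: mat_diag_def)
  then show ?case using unitary_one by blast
next
  case (Suc n)
  let ?N = "Suc n"
  note u = unitaryD[OF Suc.prems]
  obtain v e where v: "v \<in> carrier_vec ?N" "v \<noteq> 0\<^sub>v ?N" and ev: "U *\<^sub>v v = e \<cdot>\<^sub>v v"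
    using exists_eigenvector[OF u(1)] by auto
  obtain W c where W: "W \<in> carrier (unitary_group ?N)" and Wc: "\<And>i. i < ?N \<Longrightarrow> W $$ (i, 0) = c * v $ i"
    using unitary_completion[OF v] by auto
  note w = unitaryD[OF W]
  define T where "T = mat_adjoint W * (U * W)"
  have T: "T \<in> carrier (unitary_group ?N)"
    unfolding T_def by (intro unitary_mult unitary_adjoint W Suc.prems)
  note t = unitaryD[OF T]
  have UW: "(U * W) $$ (k, 0) = e * W $$ (k, 0)" if k: "k < ?N" for k
  proof -
    have "(U * W) $$ (k, 0) = c * (\<Sum>l<?N. U $$ (k, l) * v $ l)"
      unfolding mat_mult_entry[OF u(1) w(1) k zero_less_Suc]
      by (auto simp: Wc sum_distrib_left mult_ac simp del: sum.lessThan_Suc intro!: sum.cong)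
    also have "(\<Sum>l<?N. U $$ (k, l) * v $ l) = (U *\<^sub>v v) $ k"
      using u(1) v(1) k by (simp add: scalar_prod_def atLeast0LessThan del: sum.lessThan_Suc sum.op_ivl_Suc)
    also have "\<dots> = e * v $ k" using v(1) k by (simp add: ev)
    finally show ?thesis using k by (simp add: Wc)
  qed
  have col0: "T $$ (i, 0) = (if i = 0 then e else 0)" if i: "i < ?N" for i
  proof -
    have "T $$ (i, 0) = (\<Sum>l<?N. mat_adjoint W $$ (i, l) * (U * W) $$ (l, 0))"
      unfolding T_def using u w i by (intro mat_mult_entry i) auto
    also have "\<dots> = e * (\<Sum>l<?N. mat_adjoint W $$ (i, l) * W $$ (l, 0))"
      by (auto simp: UW sum_distrib_left mult_ac simp del: sum.lessThan_Suc intro!: sum.cong)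
    also have "(\<Sum>l<?N. mat_adjoint W $$ (i, l) * W $$ (l, 0)) = 1\<^sub>m ?N $$ (i, 0)"
      using mat_mult_entry[OF w(2,1) i zero_less_Suc] w(3) by simp
    finally show ?thesis using i by simp
  qed
  have row0: "T $$ (0, Suc j) = 0" if j: "j < n" for j
  proof -
    have "(\<Sum>k<?N. (cmod (T $$ (k, 0)))\<^sup>2) = (cmod e)\<^sup>2"
      unfolding sum.lessThan_Suc_shift by (simp add: col0)
    then have "(cmod e)\<^sup>2 = 1" using unitary_sum_cmod(1)[OF T zero_less_Suc] by simp
    moreover have "(\<Sum>k<?N. (cmod (T $$ (0, k)))\<^sup>2) = (cmod e)\<^sup>2 + (\<Sum>k<n. (cmod (T $$ (0, Suc k)))\<^sup>2)"
      unfolding sum.lessThan_Suc_shift by (simp add: col0)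
    ultimately have "(\<Sum>k<n. (cmod (T $$ (0, Suc k)))\<^sup>2) = 0"
      using unitary_sum_cmod(2)[OF T zero_less_Suc] by simp
    then show ?thesis using j by (simp add: sum_nonneg_eq_0_iff)
  qed
  define B where "B = mat n n (\<lambda>(i, j). T $$ (Suc i, Suc j))"
  have B: "B \<in> carrier_mat n n" by (simp add: B_def)
  have TB: "T = bordered e B"
  proof (rule eq_matI)
    fix i j assume "i < dim_row (bordered e B)" "j < dim_col (bordered e B)"
    then show "T $$ (i, j) = bordered e B $$ (i, j)"
      using col0 row0 by (cases i; cases j) (auto simp: bordered_def B_def)
  qed (use t(1) in \<open>auto simp: bordered_def B_def\<close>)
  have "bordered (cnj e * e) (mat_adjoint B * B) = bordered 1 (1\<^sub>m n)"
    using t(3) unfolding TB bordered_adjoint bordered_one bordered_mult[OF mat_adjoint_carrier[OF B] B] .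
  then have "mat_adjoint B * B = 1\<^sub>m n"
    by (rule bordered_inj[OF _ mult_carrier_mat[OF mat_adjoint_carrier[OF B] B] one_carrier_mat])
  then obtain V d where V: "V \<in> carrier (unitary_group n)" and BV: "B = V * mat_diag n d * mat_adjoint V"
    using Suc.IH[OF unitaryI[OF B]] by blast
  note vv = unitaryD[OF V]
  define P where "P = bordered 1 V"
  have Pc: "P \<in> carrier_mat ?N ?N" unfolding P_def by (rule bordered_carrier[OF vv(1)])
  have P: "P \<in> carrier (unitary_group ?N)"
    by (rule unitaryI[OF Pc]) (simp add: P_def bordered_adjoint bordered_mult[OF vv(2,1)] vv(3) bordered_one)
  let ?D = "mat_diag ?N (case_nat e d)"
  have dV: "V * mat_diag n d \<in> carrier_mat n n" using vv(1) by auto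
  have "P * ?D * mat_adjoint P = bordered e B"
    unfolding P_def bordered_mat_diag[symmetric] bordered_adjoint
      bordered_mult[OF vv(1) mat_diag_dim] bordered_mult[OF dV vv(2)] BV by simp
  then have TP: "T = P * ?D * mat_adjoint P" by (simp add: TB)
  have "U = W * (T * mat_adjoint W)"
  proof -
    have UW: "U * W \<in> carrier_mat ?N ?N" using u w by auto
    have "W * T = U * W" unfolding T_def by (rule unitary_cancel_left(2)[OF W UW])
    then have "W * (T * mat_adjoint W) = U * W * mat_adjoint W"
      using assoc_mult_square_mat[OF w(1) t(1) w(2)] by simp
    also have "\<dots> = U * (W * mat_adjoint W)" by (rule assoc_mult_square_mat[OF u(1) w(1,2)])
    finally show ?thesis using u w by simp
  qed
  also have "\<dots> = W * (P * ?D * mat_adjoint P * mat_adjoint W)" by (simp add: TP)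
  also have "\<dots> = (W * P) * ?D * mat_adjoint (W * P)"
  proof -
    note p = unitaryD[OF P]
    have D: "?D \<in> carrier_mat ?N ?N" by simp
    have "P * ?D * mat_adjoint P * mat_adjoint W = P * (?D * mat_adjoint (W * P))"
      unfolding mat_adjoint_mult[OF w(1) p(1)]
        assoc_mult_square_mat[OF mult_carrier_mat[OF p(1) D] p(2) w(2)]
      by (rule assoc_mult_square_mat[OF p(1) D mult_carrier_mat[OF p(2) w(2)]])
    moreover have "W * (P * (?D * mat_adjoint (W * P))) = (W * P) * ?D * mat_adjoint (W * P)"
    proof -
      have WP: "W * P \<in> carrier_mat ?N ?N" "mat_adjoint (W * P) \<in> carrier_mat ?N ?N"
        using w p by (auto intro: mat_adjoint_carrier)
      have "(W * P) * ?D * mat_adjoint (W * P) = (W * P) * (?D * mat_adjoint (W * P))"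
        by (rule assoc_mult_square_mat[OF WP(1) D WP(2)])
      also have "\<dots> = W * (P * (?D * mat_adjoint (W * P)))"
        by (rule assoc_mult_square_mat[OF w(1) p(1) mult_carrier_mat[OF D WP(2)]])
      finally show ?thesis by simp
    qed
    ultimately show ?thesis by simp
  qed
  finally show ?case using unitary_mult[OF W P] by blast
qed

section \<open>Schatten norms of matrices with a singular value decomposition\<close>

text \<open>
  The entries of \<open>s\<close> may be arbitrary complex numbers, so the singular values of \<open>A\<close> are their moduli.
  This avoids moving phases into the unitary factors.
\<close>

definition singular_decomposition :: "nat \<Rightarrow> complex mat \<Rightarrow> (nat \<Rightarrow> complex) \<Rightarrow> bool" where
  "singular_decomposition n A s \<longleftrightarrow> (\<exists>W\<in>carrier (unitary_group n). \<exists>V\<in>carrier (unitary_group n).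
     A = W * mat_diag n s * mat_adjoint V)"

lemma mat_diag_conj_entry:
  assumes P: "P \<in> carrier_mat n n" and Q: "Q \<in> carrier_mat n n" and ij: "i < n" "j < n"
  shows "(P * mat_diag n d * Q) $$ (i, j) = (\<Sum>k<n. P $$ (i, k) * d k * Q $$ (k, j))"
proof -
  have "P * mat_diag n d \<in> carrier_mat n n" using P by auto
  from mat_mult_entry[OF this Q ij]
  show ?thesis using P ij by (simp add: mat_diag_mult_right[OF P])
qed

lemma trace_unitary_conj:
  assumes V: "V \<in> carrier (unitary_group n)"
  shows "mat_trace (V * mat_diag n d * mat_adjoint V) = (\<Sum>k<n. d k)"
proof -
  note v = unitaryD[OF V]
  have "mat_trace (V * mat_diag n d * mat_adjoint V)
      = (\<Sum>i<n. \<Sum>k<n. V $$ (i, k) * d k * mat_adjoint V $$ (k, i))"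
    using v(1) by (simp add: mat_trace_def mat_diag_conj_entry[OF v(1,2)] del: index_mult_mat(1))
  also have "\<dots> = (\<Sum>k<n. \<Sum>i<n. d k * complex_of_real ((cmod (V $$ (i, k)))\<^sup>2))"
    unfolding complex_norm_square
    using v(1) by (subst sum.swap) (auto simp: mat_adjoint_entry mult_ac intro!: sum.cong)
  also have "\<dots> = (\<Sum>k<n. d k * complex_of_real (\<Sum>i<n. (cmod (V $$ (i, k)))\<^sup>2))"
    by (simp add: sum_distrib_left)
  also have "\<dots> = (\<Sum>k<n. d k)" using unitary_sum_cmod(1)[OF V] by simp
  finally show ?thesis .
qed

text \<open>
  \<open>A\<^sup>* A = V diag(\<bar>s\<bar>\<^sup>2) V\<^sup>*\<close>, so the functional calculus is explicit.
\<close>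

lemma singular_decomposition_abs_mat:
  assumes W: "W \<in> carrier (unitary_group n)" and V: "V \<in> carrier (unitary_group n)"
    and A: "A = W * mat_diag n s * mat_adjoint V"
  shows "abs_mat A = V * mat_diag n (\<lambda>i. complex_of_real (cmod (s i))) * mat_adjoint V"
proof -
  note w = unitaryD[OF W] and v = unitaryD[OF V]
  let ?D = "mat_diag n s" and ?D' = "mat_diag n (\<lambda>i. cnj (s i))"
  have D: "?D \<in> carrier_mat n n" "?D' \<in> carrier_mat n n" by auto
  have DV: "?D * mat_adjoint V \<in> carrier_mat n n" by (rule mult_carrier_mat[OF D(1) v(2)])
  have A': "A = W * (?D * mat_adjoint V)" unfolding A by (rule assoc_mult_square_mat[OF w(1) D(1) v(2)])
  have "mat_adjoint A = mat_adjoint (?D * mat_adjoint V) * mat_adjoint W"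
    unfolding A' by (rule mat_adjoint_mult[OF w(1) DV])
  also have "mat_adjoint (?D * mat_adjoint V) = V * ?D'"
    unfolding mat_adjoint_mult[OF D(1) v(2)] by (simp add: mat_adjoint_adjoint mat_adjoint_mat_diag)
  finally have "mat_adjoint A * A = V * ?D' * mat_adjoint W * (W * (?D * mat_adjoint V))" by (simp add: A')
  also have "\<dots> = V * ?D' * (mat_adjoint W * (W * (?D * mat_adjoint V)))"
    by (rule assoc_mult_square_mat[OF mult_carrier_mat[OF v(1) D(2)] w(2) mult_carrier_mat[OF w(1) DV]])
  also have "\<dots> = V * ?D' * (?D * mat_adjoint V)" by (simp only: unitary_cancel_left(1)[OF W DV])
  also have "\<dots> = V * (?D' * (?D * mat_adjoint V))" by (rule assoc_mult_square_mat[OF v(1) D(2) DV])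
  also have "?D' * (?D * mat_adjoint V) = (?D' * ?D) * mat_adjoint V"
    by (rule assoc_mult_square_mat[OF D(2,1) v(2), symmetric])
  also have "?D' * ?D = mat_diag n (\<lambda>i. complex_of_real ((cmod (s i))\<^sup>2))"
    unfolding complex_norm_square by (simp add: mult.commute)
  also have "V * (mat_diag n (\<lambda>i. complex_of_real ((cmod (s i))\<^sup>2)) * mat_adjoint V)
      = V * mat_diag n (\<lambda>i. complex_of_real ((cmod (s i))\<^sup>2)) * mat_adjoint V"
    by (rule assoc_mult_square_mat[OF v(1) mat_diag_dim v(2), symmetric])
  finally have "mat_adjoint A * A = V * mat_diag n (\<lambda>i. complex_of_real ((cmod (s i))\<^sup>2)) * mat_adjoint V" .
  from herm_fun_eqI[OF V this, of sqrt] show ?thesis unfolding abs_mat_def by simp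
qed

lemma schatten_norm_finite:
  assumes "singular_decomposition n A s"
  shows "schatten_norm (ereal p) A = (\<Sum>i<n. cmod (s i) powr p) powr (1 / p)"
proof -
  obtain W V where W: "W \<in> carrier (unitary_group n)" and V: "V \<in> carrier (unitary_group n)"
    and A: "A = W * mat_diag n s * mat_adjoint V"
    using assms by (auto simp: singular_decomposition_def)
  have "herm_fun (\<lambda>x. x powr p) (abs_mat A)
      = V * mat_diag n (\<lambda>i. complex_of_real (cmod (s i) powr p)) * mat_adjoint V"
    by (rule herm_fun_eqI[OF V singular_decomposition_abs_mat[OF W V A]])
  then have "mat_trace (herm_fun (\<lambda>x. x powr p) (abs_mat A)) = complex_of_real (\<Sum>i<n. cmod (s i) powr p)"
    by (simp only: trace_unitary_conj[OF V] of_real_sum)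
  then show ?thesis by (simp add: schatten_norm_def)
qed

lemma schatten_norm_finite_powr:
  assumes "singular_decomposition n A s" "p \<ge> 1"
  shows "schatten_norm (ereal p) A powr p = (\<Sum>i<n. cmod (s i) powr p)"
proof -
  have "0 \<le> (\<Sum>i<n. cmod (s i) powr p)" by (simp add: sum_nonneg)
  then show ?thesis using assms(2) unfolding schatten_norm_finite[OF assms(1)] by (simp add: powr_powr)
qed

lemma eucl_norm_unitary:
  assumes U: "U \<in> carrier (unitary_group n)" and v: "v \<in> carrier_vec n"
  shows "eucl_norm (U *\<^sub>v v) = eucl_norm v"
proof -
  note u = unitaryD[OF U]
  have entry: "(U *\<^sub>v v) $ i = (\<Sum>k<n. U $$ (i, k) * v $ k)" if "i < n" for i
    using that u(1) v by (simp add: scalar_prod_def atLeast0LessThan)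
  have "complex_of_real (\<Sum>i<n. (cmod ((U *\<^sub>v v) $ i))\<^sup>2) = (\<Sum>i<n. (U *\<^sub>v v) $ i * cnj ((U *\<^sub>v v) $ i))"
    by (simp only: complex_norm_square of_real_sum)
  also have "\<dots> = (\<Sum>i<n. \<Sum>k<n. \<Sum>l<n. (U $$ (i, k) * v $ k) * cnj (U $$ (i, l) * v $ l))"
    by (auto simp: entry sum_product cnj_sum intro!: sum.cong)
  also have "\<dots> = (\<Sum>k<n. \<Sum>l<n. \<Sum>i<n. (U $$ (i, k) * v $ k) * cnj (U $$ (i, l) * v $ l))"
    by (subst sum.swap) (rule sum.cong[OF refl], rule sum.swap)
  also have "\<dots> = (\<Sum>k<n. \<Sum>l<n. v $ k * cnj (v $ l) * (\<Sum>i<n. mat_adjoint U $$ (l, i) * U $$ (i, k)))"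
    using u(1) by (auto simp: mat_adjoint_entry sum_distrib_left mult_ac intro!: sum.cong)
  also have "\<dots> = (\<Sum>k<n. \<Sum>l<n. v $ k * cnj (v $ l) * (1\<^sub>m n $$ (l, k)))"
    by (rule sum.cong[OF refl], rule sum.cong[OF refl])
      (simp add: mat_mult_entry[OF u(2,1), symmetric] u(3) del: index_mult_mat(1))
  also have "\<dots> = (\<Sum>k<n. v $ k * cnj (v $ k))"
    by (auto simp: if_distrib[of "\<lambda>x. _ * x"] intro!: sum.cong cong: if_cong)
  also have "\<dots> = complex_of_real (\<Sum>i<n. (cmod (v $ i))\<^sup>2)"
    by (simp only: complex_norm_square of_real_sum)
  finally have "(\<Sum>i<n. (cmod ((U *\<^sub>v v) $ i))\<^sup>2) = (\<Sum>i<n. (cmod (v $ i))\<^sup>2)"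
    unfolding of_real_eq_iff .
  then show ?thesis using u(1) v by (simp add: eucl_norm_def del: index_mult_mat_vec)
qed

lemma mat_diag_vec_entry:
  assumes v: "v \<in> carrier_vec n" and i: "i < n"
  shows "(mat_diag n d *\<^sub>v v) $ i = d i * v $ i"
proof -
  have "(mat_diag n d *\<^sub>v v) $ i = (\<Sum>k<n. (if i = k then d k else 0) * v $ k)"
    using v i by (simp add: mat_diag_def scalar_prod_def atLeast0LessThan)
  also have "\<dots> = d i * v $ i"
    using i by (simp add: if_distrib[of "\<lambda>x. x * _"] cong: if_cong)
  finally show ?thesis .
qed

lemma eucl_norm_singular_decomposition:
  assumes W: "W \<in> carrier (unitary_group n)" and V: "V \<in> carrier (unitary_group n)"
    and v: "v \<in> carrier_vec n"
  shows "eucl_norm ((W * mat_diag n s * mat_adjoint V) *\<^sub>v v) = eucl_norm (mat_diag n s *\<^sub>v (mat_adjoint V *\<^sub>v v))"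
proof -
  note w = unitaryD[OF W] and vv = unitaryD[OF V]
  have V'v: "mat_adjoint V *\<^sub>v v \<in> carrier_vec n" using vv v by (auto intro: mult_mat_vec_carrier)
  have D: "mat_diag n s \<in> carrier_mat n n" by simp
  have WD: "W * mat_diag n s \<in> carrier_mat n n" by (rule mult_carrier_mat[OF w(1) D])
  have "(W * mat_diag n s * mat_adjoint V) *\<^sub>v v = W *\<^sub>v (mat_diag n s *\<^sub>v (mat_adjoint V *\<^sub>v v))"
    using assoc_mult_mat_vec[OF WD vv(2) v] assoc_mult_mat_vec[OF w(1) D V'v] by simp
  then show ?thesis using eucl_norm_unitary[OF W mult_mat_vec_carrier[OF D V'v]] by simp
qed

lemma eucl_norm_singular_decomposition_le:
  assumes W: "W \<in> carrier (unitary_group n)" and V: "V \<in> carrier (unitary_group n)"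
    and v: "v \<in> carrier_vec n" and C: "C \<ge> 0" "\<And>i. i < n \<Longrightarrow> cmod (s i) \<le> C" and v1: "eucl_norm v \<le> 1"
  shows "eucl_norm ((W * mat_diag n s * mat_adjoint V) *\<^sub>v v) \<le> C"
proof -
  define z where "z = mat_adjoint V *\<^sub>v v"
  have z: "z \<in> carrier_vec n" unfolding z_def using unitaryD[OF V] v by (auto intro: mult_mat_vec_carrier)
  have z1: "eucl_norm z \<le> 1" unfolding z_def using eucl_norm_unitary[OF unitary_adjoint[OF V] v] v1 by simp
  have "(\<Sum>i<n. (cmod ((mat_diag n s *\<^sub>v z) $ i))\<^sup>2) \<le> (\<Sum>i<n. C\<^sup>2 * (cmod (z $ i))\<^sup>2)"
  proof (rule sum_mono)
    fix i assume i: "i \<in> {..<n}"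
    have "(cmod (s i) * cmod (z $ i))\<^sup>2 \<le> (C * cmod (z $ i))\<^sup>2"
      using C i by (intro power_mono mult_right_mono) auto
    then show "(cmod ((mat_diag n s *\<^sub>v z) $ i))\<^sup>2 \<le> C\<^sup>2 * (cmod (z $ i))\<^sup>2"
      using i by (simp add: mat_diag_vec_entry[OF z] norm_mult power_mult_distrib)
  qed
  also have "\<dots> = C\<^sup>2 * (\<Sum>i<n. (cmod (z $ i))\<^sup>2)" by (simp add: sum_distrib_left)
  also have "\<dots> \<le> C\<^sup>2 * 1"
    using z1 z by (intro mult_left_mono) (auto simp: eucl_norm_def)
  finally have "sqrt (\<Sum>i<n. (cmod ((mat_diag n s *\<^sub>v z) $ i))\<^sup>2) \<le> sqrt (C\<^sup>2)"
    by (simp only: real_sqrt_le_iff mult_1_right)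
  moreover have "dim_vec (mat_diag n s *\<^sub>v z) = n" by (simp add: mat_diag_def)
  ultimately have "eucl_norm (mat_diag n s *\<^sub>v z) \<le> C" using C by (simp add: eucl_norm_def del: index_mult_mat_vec)
  then show ?thesis unfolding eucl_norm_singular_decomposition[OF W V v] z_def .
qed

lemma op_norm_le:
  assumes A: "singular_decomposition n A s" and C: "C \<ge> 0" "\<And>i. i < n \<Longrightarrow> cmod (s i) \<le> C"
  shows "op_norm A \<le> C"
proof -
  obtain W V where W: "W \<in> carrier (unitary_group n)" and V: "V \<in> carrier (unitary_group n)"
    and e: "A = W * mat_diag n s * mat_adjoint V"
    using A by (auto simp: singular_decomposition_def)
  have n: "dim_col A = n" using unitaryD[OF V] by (simp add: e)
  have zero: "0\<^sub>v n \<in> {v \<in> carrier_vec n. eucl_norm v \<le> 1}" by (simp add: eucl_norm_def)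
  have "eucl_norm (A *\<^sub>v v) \<le> C" if "v \<in> {v \<in> carrier_vec n. eucl_norm v \<le> 1}" for v
    unfolding e using that by (intro eucl_norm_singular_decomposition_le[OF W V _ C]) auto
  then show ?thesis unfolding op_norm_def n using zero by (intro cSUP_least) blast+
qed

lemma le_op_norm:
  assumes A: "singular_decomposition n A s" and v: "v \<in> carrier_vec n" "eucl_norm v \<le> 1"
  shows "eucl_norm (A *\<^sub>v v) \<le> op_norm A"
proof -
  obtain W V where W: "W \<in> carrier (unitary_group n)" and V: "V \<in> carrier (unitary_group n)"
    and e: "A = W * mat_diag n s * mat_adjoint V"
    using A by (auto simp: singular_decomposition_def)
  have n: "dim_col A = n" using unitaryD[OF V] by (simp add: e)
  have "eucl_norm (A *\<^sub>v u) \<le> (\<Sum>i<n. cmod (s i))" if "u \<in> carrier_vec n" "eucl_norm u \<le> 1" for u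
    unfolding e using that
    by (intro eucl_norm_singular_decomposition_le[OF W V] member_le_sum sum_nonneg) auto
  then have "bdd_above ((\<lambda>v. eucl_norm (A *\<^sub>v v)) ` {v \<in> carrier_vec n. eucl_norm v \<le> 1})"
    by (intro bdd_aboveI2) auto
  then show ?thesis unfolding op_norm_def n using v by (intro cSUP_upper) auto
qed

text \<open>
  The norm of \<open>A\<close> on the \<open>i\<close>-th column of \<open>V\<close> is \<open>\<bar>s\<^sub>i\<bar>\<close>.
\<close>

lemma singular_value_le_op_norm:
  assumes A: "singular_decomposition n A s" and i: "i < n"
  shows "cmod (s i) \<le> op_norm A"
proof -
  obtain W V where W: "W \<in> carrier (unitary_group n)" and V: "V \<in> carrier (unitary_group n)"
    and e: "A = W * mat_diag n s * mat_adjoint V"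
    using A by (auto simp: singular_decomposition_def)
  note vv = unitaryD[OF V]
  have unit_norm: "eucl_norm (unit_vec n i) = 1"
  proof -
    have "(\<Sum>k<n. (cmod (unit_vec n i $ k))\<^sup>2) = (\<Sum>k<n. if k = i then 1 else 0)"
      by (rule sum.cong[OF refl]) (simp add: unit_vec_def)
    moreover have "eucl_norm (unit_vec n i) = sqrt (\<Sum>k<n. (cmod (unit_vec n i $ k))\<^sup>2)"
      by (simp add: eucl_norm_def)
    ultimately show ?thesis using i by (simp only: sum.delta finite_lessThan lessThan_iff if_True real_sqrt_one)
  qed
  have ev: "unit_vec n i \<in> carrier_vec n" by simp
  define v where "v = V *\<^sub>v unit_vec n i"
  have v: "v \<in> carrier_vec n" "eucl_norm v \<le> 1"
    unfolding v_def using mult_mat_vec_carrier[OF vv(1) ev] eucl_norm_unitary[OF V ev] unit_norm by auto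
  have "mat_adjoint V *\<^sub>v v = unit_vec n i"
    unfolding v_def assoc_mult_mat_vec[OF vv(2,1) ev, symmetric] vv(3) by simp
  then have "eucl_norm (A *\<^sub>v v) = eucl_norm (mat_diag n s *\<^sub>v unit_vec n i)"
    unfolding e eucl_norm_singular_decomposition[OF W V v(1)] by simp
  also have "\<dots> = sqrt (\<Sum>k<n. (cmod ((mat_diag n s *\<^sub>v unit_vec n i) $ k))\<^sup>2)"
    by (simp add: eucl_norm_def mat_diag_def del: index_mult_mat_vec)
  also have "(\<Sum>k<n. (cmod ((mat_diag n s *\<^sub>v unit_vec n i) $ k))\<^sup>2) = (\<Sum>k<n. if k = i then (cmod (s i))\<^sup>2 else 0)"
    by (rule sum.cong[OF refl]) (use i in \<open>auto simp: mat_diag_vec_entry[OF ev] norm_mult simp del: index_mult_mat_vec\<close>)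
  also have "sqrt \<dots> = cmod (s i)" using i by simp
  finally show ?thesis using le_op_norm[OF A v] by simp
qed

lemma schatten_norm_infinity: "schatten_norm \<infinity> A = op_norm A"
  by (simp add: schatten_norm_def)

lemma ereal_ge_1_cases:
  fixes p :: ereal
  assumes "1 \<le> p"
  obtains "p = \<infinity>" | r where "p = ereal r" "r \<ge> 1"
  using assms by (cases p) auto

lemma schatten_norm_nonneg:
  assumes A: "singular_decomposition n A s" and p: "1 \<le> p"
  shows "0 \<le> schatten_norm p A"
  using p
proof (cases p rule: ereal_ge_1_cases)
  case 1
  have "0 \<le> eucl_norm (A *\<^sub>v 0\<^sub>v n)" by (simp add: eucl_norm_def sum_nonneg)
  also have "\<dots> \<le> op_norm A" by (rule le_op_norm[OF A]) (simp_all add: eucl_norm_def)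
  finally show ?thesis using 1 by (simp add: schatten_norm_infinity)
qed (simp add: schatten_norm_finite[OF A])

lemma singular_value_le_schatten_norm:
  assumes A: "singular_decomposition n A s" and p: "1 \<le> p" and i: "i < n"
  shows "cmod (s i) \<le> schatten_norm p A"
  using p
proof (cases p rule: ereal_ge_1_cases)
  case 1
  then show ?thesis using singular_value_le_op_norm[OF A i] by (simp add: schatten_norm_infinity)
next
  case (2 r)
  have "cmod (s i) powr r \<le> (\<Sum>k<n. cmod (s k) powr r)" using i by (intro member_le_sum) auto
  then have "(cmod (s i) powr r) powr (1 / r) \<le> (\<Sum>k<n. cmod (s k) powr r) powr (1 / r)"
    using 2 by (intro powr_mono2) auto
  then show ?thesis using 2 by (simp add: schatten_norm_finite[OF A] powr_powr)
qed

text \<open>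
  For finite \<open>q\<close>: with \<open>S\<close> the \<open>p\<close>-norm, every \<open>\<bar>s\<^sub>i\<bar>\<close> is at most \<open>S\<close>, whence
  \<open>\<bar>s\<^sub>i\<bar>\<^sup>q \<le> S\<^bsup>q - p\<^esup> \<bar>s\<^sub>i\<bar>\<^sup>p\<close>; summing gives \<open>S\<^sup>q\<close> on the right.
\<close>

lemma schatten_norm_antimono:
  assumes A: "singular_decomposition n A s" and p: "1 \<le> p" and q: "p \<le> q"
  shows "schatten_norm q A \<le> schatten_norm p A"
proof -
  have le: "\<And>i. i < n \<Longrightarrow> cmod (s i) \<le> schatten_norm p A" and nn: "0 \<le> schatten_norm p A"
    using singular_value_le_schatten_norm[OF A p] schatten_norm_nonneg[OF A p] by auto
  have "1 \<le> q" using p q by simp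
  then show ?thesis
  proof (cases q rule: ereal_ge_1_cases)
    case 1
    then show ?thesis using op_norm_le[OF A nn le] by (simp add: schatten_norm_infinity)
  next
    case (2 t)
    then obtain r where r: "p = ereal r" "r \<ge> 1" "r \<le> t"
      using p q by (cases p) auto
    define S where "S = schatten_norm p A"
    have "(\<Sum>i<n. cmod (s i) powr t) \<le> (\<Sum>i<n. S powr (t - r) * cmod (s i) powr r)"
    proof (rule sum_mono)
      fix i assume "i \<in> {..<n}"
      then have "cmod (s i) powr (t - r) \<le> S powr (t - r)"
        using le r by (intro powr_mono2) (auto simp: S_def)
      then have "cmod (s i) powr (t - r) * cmod (s i) powr r \<le> S powr (t - r) * cmod (s i) powr r"
        by (intro mult_right_mono) auto
      then show "cmod (s i) powr t \<le> S powr (t - r) * cmod (s i) powr r"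
        by (simp add: powr_add[symmetric])
    qed
    also have "\<dots> = S powr (t - r) * S powr r"
      using r schatten_norm_finite_powr[OF A r(2)] by (simp add: sum_distrib_left S_def)
    also have "\<dots> = S powr t" by (simp add: powr_add[symmetric])
    finally have "(\<Sum>i<n. cmod (s i) powr t) powr (1 / t) \<le> (S powr t) powr (1 / t)"
      using 2 by (intro powr_mono2 sum_nonneg) auto
    then show ?thesis using 2 nn by (simp add: schatten_norm_finite[OF A] powr_powr S_def)
  qed
qed

lemma schatten_norm_cong_abs:
  assumes "mat_adjoint A * A = mat_adjoint B * B"
  shows "schatten_norm (ereal p) A = schatten_norm (ereal p) B"
  using assms by (simp add: schatten_norm_def abs_mat_def)

lemma singular_decomposition_unitary_mult:
  assumes U: "U \<in> carrier (unitary_group n)" and A: "singular_decomposition n A s"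
  shows "singular_decomposition n (U * A) s"
proof -
  obtain W V where W: "W \<in> carrier (unitary_group n)" and V: "V \<in> carrier (unitary_group n)"
    and e: "A = W * mat_diag n s * mat_adjoint V"
    using A by (auto simp: singular_decomposition_def)
  note u = unitaryD[OF U] and w = unitaryD[OF W] and v = unitaryD[OF V]
  have D: "mat_diag n s \<in> carrier_mat n n" by simp
  have "U * A = (U * W) * mat_diag n s * mat_adjoint V"
    unfolding e assoc_mult_square_mat[OF u(1) mult_carrier_mat[OF w(1) D] v(2), symmetric]
      assoc_mult_square_mat[OF u(1) w(1) D] ..
  then show ?thesis using unitary_mult[OF U W] V by (auto simp: singular_decomposition_def)
qed

lemma diag_conj_minus_one:
  assumes V: "V \<in> carrier (unitary_group n)"
  shows "V * mat_diag n d * mat_adjoint V - 1\<^sub>m n = V * mat_diag n (\<lambda>i. d i - 1) * mat_adjoint V"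
proof (rule eq_matI)
  note v = unitaryD[OF V]
  fix i j assume "i < dim_row (V * mat_diag n (\<lambda>i. d i - 1) * mat_adjoint V)"
    "j < dim_col (V * mat_diag n (\<lambda>i. d i - 1) * mat_adjoint V)"
  then have ij: "i < n" "j < n" using v by auto
  have "1\<^sub>m n $$ (i, j) = (\<Sum>k<n. V $$ (i, k) * mat_adjoint V $$ (k, j))"
    using mat_mult_entry[OF v(1,2) ij] v(4) by simp
  then show "(V * mat_diag n d * mat_adjoint V - 1\<^sub>m n) $$ (i, j)
      = (V * mat_diag n (\<lambda>i. d i - 1) * mat_adjoint V) $$ (i, j)"
    using ij v by (simp add: mat_diag_conj_entry[OF v(1,2)] sum_subtractf algebra_simps
        del: index_mult_mat(1) index_one_mat(1))
qed (use unitaryD[OF V] in auto)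

text \<open>
  \<open>U - V = V (V\<^sup>* U - 1)\<close>, and \<open>V\<^sup>* U\<close> is unitary, hence diagonalizable.
\<close>

lemma singular_decomposition_unitary_diff:
  assumes U: "U \<in> carrier (unitary_group n)" and V: "V \<in> carrier (unitary_group n)"
  shows "\<exists>s. singular_decomposition n (U - V) s"
proof -
  note u = unitaryD[OF U] and v = unitaryD[OF V]
  obtain W d where W: "W \<in> carrier (unitary_group n)" and e: "mat_adjoint V * U = W * mat_diag n d * mat_adjoint W"
    using unitary_diagonalization[OF unitary_mult[OF unitary_adjoint[OF V] U]] by blast
  have "mat_adjoint V * U - 1\<^sub>m n = W * mat_diag n (\<lambda>i. d i - 1) * mat_adjoint W"
    unfolding e by (rule diag_conj_minus_one[OF W])
  then have "singular_decomposition n (mat_adjoint V * U - 1\<^sub>m n) (\<lambda>i. d i - 1)"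
    using W by (auto simp: singular_decomposition_def)
  then have "singular_decomposition n (V * (mat_adjoint V * U - 1\<^sub>m n)) (\<lambda>i. d i - 1)"
    by (rule singular_decomposition_unitary_mult[OF V])
  moreover have "V * (mat_adjoint V * U - 1\<^sub>m n) = U - V"
    using v u mult_minus_distrib_mat[OF v(1) mult_carrier_mat[OF v(2) u(1)] one_carrier_mat]
      unitary_cancel_left(2)[OF V u(1)] by simp
  ultimately show ?thesis by auto
qed

text \<open>
  Singular values may vanish, so convexity is wanted on the closed half-line.
\<close>

lemma powr_convex_nonneg:
  assumes p: "p \<ge> (1::real)"
  shows "convex_on {0..} (\<lambda>x. x powr p)"
proof (rule convex_onI)
  fix t x y :: real assume t: "0 < t" "t < 1" and "x \<in> {0..}" "y \<in> {0..}"
  then have xy: "x \<ge> 0" "y \<ge> 0" by auto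
  have small: "(u * z) powr p \<le> u * z powr p" if "0 < u" "u < 1" "z \<ge> 0" for u z :: real
  proof -
    have "u powr p \<le> u powr 1" using that p by (intro powr_mono') auto
    then show ?thesis using that by (simp add: powr_mult mult_right_mono)
  qed
  show "((1 - t) *\<^sub>R x + t *\<^sub>R y) powr p \<le> (1 - t) * x powr p + t * y powr p"
  proof (cases "x = 0 \<or> y = 0")
    case True
    then show ?thesis using small[of t y] small[of "1 - t" x] t xy p by auto
  next
    case False
    then show ?thesis using convex_onD[OF powr_convex[OF p], of t x y] t xy by auto
  qed
qed simp

text \<open>
  The diagonal entries of \<open>A\<close> in the orthonormal basis \<open>Z\<close> are \<open>\<Sum>\<^sub>k P\<^sub>i\<^sub>k s\<^sub>k Q\<^sub>k\<^sub>i\<close> with \<open>P\<close>, \<open>Q\<close>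
  unitary.  By the inequality of arithmetic and geometric means, their moduli are at most
  \<open>\<Sum>\<^sub>k m\<^sub>i\<^sub>k \<bar>s\<^sub>k\<bar>\<close> for the doubly stochastic matrix \<open>m\<^sub>i\<^sub>k = (\<bar>P\<^sub>i\<^sub>k\<bar>\<^sup>2 + \<bar>Q\<^sub>k\<^sub>i\<bar>\<^sup>2) / 2\<close>; Jensen's
  inequality in each row and summation over the columns finish the proof.
\<close>

lemma sum_powr_diagonal_le:
  assumes A: "singular_decomposition n A s" and Z: "Z \<in> carrier (unitary_group n)" and p: "p \<ge> 1"
  shows "(\<Sum>i<n. cmod ((mat_adjoint Z * A * Z) $$ (i, i)) powr p) \<le> (\<Sum>k<n. cmod (s k) powr p)"
proof -
  obtain W V where W: "W \<in> carrier (unitary_group n)" and V: "V \<in> carrier (unitary_group n)"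
    and e: "A = W * mat_diag n s * mat_adjoint V"
    using A by (auto simp: singular_decomposition_def)
  note w = unitaryD[OF W] and v = unitaryD[OF V] and z = unitaryD[OF Z]
  define P where "P = mat_adjoint Z * W"
  define Q where "Q = mat_adjoint V * Z"
  have P: "P \<in> carrier (unitary_group n)" and Q: "Q \<in> carrier (unitary_group n)"
    unfolding P_def Q_def by (intro unitary_mult unitary_adjoint W V Z)+
  note pc = unitaryD(1)[OF P] and qc = unitaryD(1)[OF Q]
  have "mat_adjoint Z * A * Z = P * mat_diag n s * Q"
  proof -
    have D: "mat_diag n s \<in> carrier_mat n n" by simp
    have "mat_adjoint Z * A = P * mat_diag n s * mat_adjoint V"
      unfolding e P_def assoc_mult_square_mat[OF z(2) mult_carrier_mat[OF w(1) D] v(2), symmetric]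
        assoc_mult_square_mat[OF z(2) w(1) D] ..
    then show ?thesis
      unfolding Q_def using assoc_mult_square_mat[OF mult_carrier_mat[OF pc D] v(2) z(1)] by simp
  qed
  define m where "m i k = ((cmod (P $$ (i, k)))\<^sup>2 + (cmod (Q $$ (k, i)))\<^sup>2) / 2" for i k
  have row: "(\<Sum>k<n. m i k) = 1" and col: "(\<Sum>k<n. m k i) = 1" if "i < n" for i
    using unitary_sum_cmod[OF P that] unitary_sum_cmod[OF Q that]
    by (simp_all add: m_def sum.distrib flip: sum_divide_distrib)
  have "cmod ((mat_adjoint Z * A * Z) $$ (i, i)) powr p \<le> (\<Sum>k<n. m i k * cmod (s k) powr p)" if i: "i < n" for i
  proof -
    have "cmod ((mat_adjoint Z * A * Z) $$ (i, i)) \<le> (\<Sum>k<n. m i k * cmod (s k))"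
      unfolding \<open>mat_adjoint Z * A * Z = P * mat_diag n s * Q\<close> mat_diag_conj_entry[OF pc qc i i]
    proof (rule sum_norm_le)
      fix k
      have "cmod (P $$ (i, k)) * cmod (Q $$ (k, i)) \<le> m i k"
        using sum_squares_bound[of "cmod (P $$ (i, k))" "cmod (Q $$ (k, i))"] by (simp add: m_def)
      then have "cmod (P $$ (i, k)) * cmod (Q $$ (k, i)) * cmod (s k) \<le> m i k * cmod (s k)"
        by (rule mult_right_mono) simp
      then show "cmod (P $$ (i, k) * s k * Q $$ (k, i)) \<le> m i k * cmod (s k)"
        by (simp add: norm_mult mult_ac)
    qed
    then have "cmod ((mat_adjoint Z * A * Z) $$ (i, i)) powr p \<le> (\<Sum>k<n. m i k * cmod (s k)) powr p"
      using p by (intro powr_mono2) auto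
    also have "\<dots> \<le> (\<Sum>k<n. m i k * cmod (s k) powr p)"
      using convex_on_sum[OF _ _ powr_convex_nonneg[OF p] row[OF i], of "\<lambda>k. cmod (s k)"] i
      by (auto simp: m_def)
    finally show ?thesis .
  qed
  then have "(\<Sum>i<n. cmod ((mat_adjoint Z * A * Z) $$ (i, i)) powr p) \<le> (\<Sum>i<n. \<Sum>k<n. m i k * cmod (s k) powr p)"
    by (intro sum_mono) auto
  also have "\<dots> = (\<Sum>k<n. (\<Sum>i<n. m i k) * cmod (s k) powr p)"
    by (subst sum.swap) (simp add: sum_distrib_right)
  also have "\<dots> = (\<Sum>k<n. cmod (s k) powr p)" using col by simp
  finally show ?thesis .
qed

lemma add_powr_le:
  assumes "a \<ge> 0" "b \<ge> 0" "p \<ge> (1::real)"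
  shows "a powr p + b powr p \<le> (a + b) powr p"
proof -
  have *: "x powr p \<le> x * (a + b) powr (p - 1)" if "0 \<le> x" "x \<le> a + b" for x
  proof (cases "x = 0")
    case False
    have "x powr p = x * x powr (p - 1)" using that False powr_add[of x 1 "p - 1"] by simp
    also have "\<dots> \<le> x * (a + b) powr (p - 1)" using that assms by (intro mult_left_mono powr_mono2) auto
    finally show ?thesis .
  qed (use assms in simp)
  have "a powr p + b powr p \<le> (a + b) * (a + b) powr (p - 1)"
    using *[of a] *[of b] assms by (simp add: algebra_simps)
  also have "\<dots> = (a + b) powr p"
    using assms powr_add[of "a + b" 1 "p - 1"] by (cases "a + b = 0") auto
  finally show ?thesis .
qed

text \<open>
  Here \<open>U\<close> stands for \<open>\<phi>(J)\<close> and \<open>E\<close> for \<open>\<phi>(1)\<close>, the only available approximation of \<open>U\<^sup>2\<close>.  In an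
  eigenbasis of \<open>U\<close>, with eigenvalues \<open>1 + s\<^sub>i\<close>, the diagonal of \<open>U\<^sup>2 - 1 = (E - 1) - (E - U\<^sup>2)\<close> is
  \<open>s\<^sub>i (2 + s\<^sub>i)\<close>.  The diagonals of both terms on the right are bounded in \<open>\<ell>\<^sup>p\<close> by their Schatten
  norms, and \<open>\<bar>s\<^sub>i\<bar> < 1\<close> gives \<open>\<bar>s\<^sub>i\<bar> \<le> \<bar>s\<^sub>i (2 + s\<^sub>i)\<bar>\<close>.
\<close>

lemma dist_one_le_of_almost_involution:
  assumes U: "U \<in> carrier (unitary_group n)" and E: "E \<in> carrier (unitary_group n)"
    and p: "1 \<le> p" and q: "1 \<le> q" and near: "schatten_dist q n U (1\<^sub>m n) < 1"
  shows "schatten_dist (ereal p) n U (1\<^sub>m n)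
    \<le> 2 * (schatten_dist (ereal p) n E (U * U) + schatten_dist (ereal p) n E (1\<^sub>m n))"
proof -
  obtain V d where V: "V \<in> carrier (unitary_group n)" and Ud: "U = V * mat_diag n d * mat_adjoint V"
    using unitary_diagonalization[OF U] by blast
  note u = unitaryD[OF U] and v = unitaryD[OF V] and ee = unitaryD[OF E]
  let ?D = "mat_diag n d"
  have D: "?D \<in> carrier_mat n n" by simp
  define s where "s i = d i - 1" for i
  have dec: "singular_decomposition n (U - 1\<^sub>m n) s"
    unfolding Ud diag_conj_minus_one[OF V] singular_decomposition_def s_def using V by blast
  obtain a where a: "singular_decomposition n (E - U * U) a"
    using singular_decomposition_unitary_diff[OF E unitary_mult[OF U U]] by blast
  obtain b where b: "singular_decomposition n (E - 1\<^sub>m n) b"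
    using singular_decomposition_unitary_diff[OF E unitary_one] by blast
  let ?x = "\<lambda>i. (mat_adjoint V * (E - U * U) * V) $$ (i, i)"
  let ?y = "\<lambda>i. (mat_adjoint V * (E - 1\<^sub>m n) * V) $$ (i, i)"
  have UU: "mat_adjoint V * (U * U) * V = mat_diag n (\<lambda>i. d i * d i)"
  proof -
    have DV: "?D * mat_adjoint V \<in> carrier_mat n n" by (rule mult_carrier_mat[OF D v(2)])
    have DD: "?D * (?D * mat_adjoint V) \<in> carrier_mat n n" by (rule mult_carrier_mat[OF D DV])
    have U': "U = V * (?D * mat_adjoint V)" unfolding Ud by (rule assoc_mult_square_mat[OF v(1) D v(2)])
    have "U * U = V * (?D * mat_adjoint V * U)"
      by (subst (1) U') (rule assoc_mult_square_mat[OF v(1) DV u(1)])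
    also have "?D * mat_adjoint V * U = ?D * (mat_adjoint V * U)"
      by (rule assoc_mult_square_mat[OF D v(2) u(1)])
    also have "mat_adjoint V * U = ?D * mat_adjoint V"
      unfolding U' by (rule unitary_cancel_left(1)[OF V DV])
    finally have "mat_adjoint V * (U * U) = ?D * (?D * mat_adjoint V)"
      using unitary_cancel_left(1)[OF V DD] by simp
    also have "\<dots> = ?D * ?D * mat_adjoint V" by (rule assoc_mult_square_mat[OF D D v(2), symmetric])
    finally have "mat_adjoint V * (U * U) * V = ?D * ?D * mat_adjoint V * V" by simp
    also have "\<dots> = ?D * ?D * (mat_adjoint V * V)"
      by (rule assoc_mult_square_mat[OF _ v(2,1)]) simp
    finally show ?thesis by (simp add: v(3) right_mult_one_mat[OF mat_diag_dim])
  qed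
  have diff: "?y i - ?x i = s i * (2 + s i)" if i: "i < n" for i
  proof -
    have UUc: "U * U \<in> carrier_mat n n" and VE: "mat_adjoint V * E \<in> carrier_mat n n"
      by (rule mult_carrier_mat[OF u(1) u(1)], rule mult_carrier_mat[OF v(2) ee(1)])
    have "mat_adjoint V * (E - U * U) * V = mat_adjoint V * E * V - mat_diag n (\<lambda>i. d i * d i)"
      unfolding mult_minus_distrib_mat[OF v(2) ee(1) UUc]
        minus_mult_distrib_mat[OF VE mult_carrier_mat[OF v(2) UUc] v(1)] UU ..
    moreover have "mat_adjoint V * (E - 1\<^sub>m n) * V = mat_adjoint V * E * V - 1\<^sub>m n"
      unfolding mult_minus_distrib_mat[OF v(2) ee(1) one_carrier_mat]
        minus_mult_distrib_mat[OF VE mult_carrier_mat[OF v(2) one_carrier_mat] v(1)]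
      using v by simp
    ultimately show ?thesis using i v ee
      by (simp add: mat_diag_def s_def algebra_simps del: index_mult_mat(1))
  qed
  have pointwise: "cmod (s i) powr p \<le> 2 powr p * (cmod (?x i) powr p + cmod (?y i) powr p)" if i: "i < n" for i
  proof -
    have s1: "cmod (s i) < 1"
      using singular_value_le_schatten_norm[OF dec q i] near by (simp add: schatten_dist_def)
    have "2 - cmod (s i) \<le> cmod (2 + s i)" using norm_diff_ineq[of 2 "s i"] by simp
    then have "1 \<le> cmod (2 + s i)" using s1 by simp
    then have "cmod (s i) \<le> cmod (s i * (2 + s i))" by (simp add: norm_mult mult_le_cancel_left1)
    also have "\<dots> \<le> cmod (?y i) + cmod (?x i)" unfolding diff[OF i, symmetric] by (rule norm_triangle_ineq4)
    also have "\<dots> \<le> 2 * max (cmod (?x i)) (cmod (?y i))" by simp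
    finally have "cmod (s i) powr p \<le> (2 * max (cmod (?x i)) (cmod (?y i))) powr p"
      using p by (intro powr_mono2) auto
    also have "\<dots> = 2 powr p * max (cmod (?x i)) (cmod (?y i)) powr p" by (simp add: powr_mult)
    also have "\<dots> \<le> 2 powr p * (cmod (?x i) powr p + cmod (?y i) powr p)"
      by (intro mult_left_mono) (auto simp: max_def)
    finally show ?thesis .
  qed
  let ?N = "schatten_norm (ereal p)"
  have nn: "0 \<le> ?N (E - U * U)" "0 \<le> ?N (E - 1\<^sub>m n)" "0 \<le> ?N (U - 1\<^sub>m n)"
    using schatten_norm_nonneg[OF a] schatten_norm_nonneg[OF b] schatten_norm_nonneg[OF dec] p by auto
  have "?N (U - 1\<^sub>m n) powr p = (\<Sum>i<n. cmod (s i) powr p)" by (rule schatten_norm_finite_powr[OF dec p])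
  also have "\<dots> \<le> (\<Sum>i<n. 2 powr p * (cmod (?x i) powr p + cmod (?y i) powr p))"
    by (intro sum_mono pointwise) simp
  also have "\<dots> = 2 powr p * ((\<Sum>i<n. cmod (?x i) powr p) + (\<Sum>i<n. cmod (?y i) powr p))"
    by (simp only: sum_distrib_left[symmetric] sum.distrib)
  also have "\<dots> \<le> 2 powr p * (?N (E - U * U) powr p + ?N (E - 1\<^sub>m n) powr p)"
    unfolding schatten_norm_finite_powr[OF a p] schatten_norm_finite_powr[OF b p]
    by (intro mult_left_mono add_mono sum_powr_diagonal_le a b V p) simp
  also have "\<dots> \<le> 2 powr p * (?N (E - U * U) + ?N (E - 1\<^sub>m n)) powr p"
    by (intro mult_left_mono add_powr_le nn p) simp
  also have "\<dots> = (2 * (?N (E - U * U) + ?N (E - 1\<^sub>m n))) powr p"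
    using nn by (simp add: powr_mult del: distrib_left_numeral)
  finally have le: "?N (U - 1\<^sub>m n) powr p \<le> (2 * (?N (E - U * U) + ?N (E - 1\<^sub>m n))) powr p" .
  have "?N (U - 1\<^sub>m n) \<le> 2 * (?N (E - U * U) + ?N (E - 1\<^sub>m n))"
  proof (rule ccontr)
    assume "\<not> ?thesis"
    then have "(2 * (?N (E - U * U) + ?N (E - 1\<^sub>m n))) powr p < ?N (U - 1\<^sub>m n) powr p"
      using p nn by (intro powr_less_mono2) auto
    then show False using le by simp
  qed
  then show ?thesis by (simp only: schatten_dist_def)
qed

section \<open>Almost involutions and groups of Deligne type\<close>

lemma schatten_dist_nonneg:
  assumes "U \<in> carrier (unitary_group n)" "V \<in> carrier (unitary_group n)" "1 \<le> p"
  shows "0 \<le> schatten_dist p n U V"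
  using singular_decomposition_unitary_diff[OF assms(1,2)] schatten_norm_nonneg assms(3)
  by (auto simp: schatten_dist_def)

lemma schatten_dist_antimono:
  assumes "U \<in> carrier (unitary_group n)" "V \<in> carrier (unitary_group n)" "1 \<le> p" "p \<le> q"
  shows "schatten_dist q n U V \<le> schatten_dist p n U V"
  using singular_decomposition_unitary_diff[OF assms(1,2)] schatten_norm_antimono assms(3,4)
  by (auto simp: schatten_dist_def)

text \<open>
  \<open>E - E\<^sup>2 = E (1 - E)\<close>, and a unitary factor on the left does not change \<open>A\<^sup>* A\<close>.  Applied to
  \<open>E = \<phi>(1)\<close>, this shows that an asymptotic homomorphism is asymptotically unital.
\<close>

lemma schatten_dist_square_self:
  assumes E: "E \<in> carrier (unitary_group n)"
  shows "schatten_dist (ereal p) n E (E * E) = schatten_dist (ereal p) n E (1\<^sub>m n)"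
proof -
  note e = unitaryD[OF E]
  let ?A = "E - 1\<^sub>m n"
  have A: "?A \<in> carrier_mat n n" by (rule minus_carrier_mat[OF one_carrier_mat])
  have E': "E - E * E = E * (- ?A)"
  proof -
    have "- ?A = 1\<^sub>m n - E" by (rule eq_matI) (use e in auto)
    then show ?thesis using mult_minus_distrib_mat[OF e(1) one_carrier_mat e(1)] e(1) by simp
  qed
  have nA: "- ?A \<in> carrier_mat n n" using A by auto
  have "mat_adjoint (E - E * E) * (E - E * E) = mat_adjoint (- ?A) * mat_adjoint E * (E * (- ?A))"
    unfolding E' mat_adjoint_mult[OF e(1) nA] ..
  also have "\<dots> = mat_adjoint (- ?A) * (mat_adjoint E * (E * (- ?A)))"
    by (rule assoc_mult_square_mat[OF mat_adjoint_carrier[OF nA] e(2) mult_carrier_mat[OF e(1) nA]])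
  also have "\<dots> = mat_adjoint (- ?A) * (- ?A)" by (simp only: unitary_cancel_left(1)[OF E nA])
  also have "\<dots> = mat_adjoint ?A * ?A"
  proof -
    have "mat_adjoint (- ?A) = - mat_adjoint ?A"
      by (rule eq_matI) (use A in \<open>auto simp: mat_adjoint_entry\<close>)
    then show ?thesis
      using A mat_adjoint_carrier[OF A] by (auto simp: uminus_mult_left_mat uminus_mult_right_mat)
  qed
  finally show ?thesis unfolding schatten_dist_def by (rule schatten_norm_cong_abs)
qed

lemma asymptotic_hom_antimono:
  assumes G: "group \<Gamma>" and hom: "asymptotic_hom unitary_group (schatten_dist p) \<Gamma> \<phi>"
    and p: "1 \<le> p" and q: "p \<le> q"
  shows "asymptotic_hom unitary_group (schatten_dist q) \<Gamma> \<phi>"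
  unfolding asymptotic_hom_def
proof (intro conjI allI ballI)
  interpret group \<Gamma> by (rule G)
  show in_U: "\<phi> n \<in> carrier \<Gamma> \<rightarrow> carrier (unitary_group n)" for n
    using hom by (simp add: asymptotic_hom_def)
  fix g h assume g: "g \<in> carrier \<Gamma>" and h: "h \<in> carrier \<Gamma>"
  let ?a = "\<lambda>n. \<phi> n (g \<otimes>\<^bsub>\<Gamma>\<^esub> h)" and ?b = "\<lambda>n. \<phi> n g \<otimes>\<^bsub>unitary_group n\<^esub> \<phi> n h"
  have a: "?a n \<in> carrier (unitary_group n)" for n
    using in_U g h by (meson PiE m_closed)
  have b: "?b n \<in> carrier (unitary_group n)" for n
    using unitary_mult[of "\<phi> n g" n "\<phi> n h"] in_U[of n] g h by (auto simp: Pi_iff)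
  have lim: "(\<lambda>n. schatten_dist p n (?a n) (?b n)) \<longlonglongrightarrow> 0"
    using hom g h by (simp add: asymptotic_hom_def)
  have q1: "1 \<le> q" using p q by simp
  show "(\<lambda>n. schatten_dist q n (?a n) (?b n)) \<longlonglongrightarrow> 0"
    by (rule tendsto_sandwich[OF _ _ tendsto_const lim])
      (intro always_eventually allI schatten_dist_nonneg schatten_dist_antimono a b p q q1)+
qed

lemma dist_one_tendsto_zero_of_near:
  assumes G: "group \<Gamma>" and hom: "asymptotic_hom unitary_group (schatten_dist (ereal p)) \<Gamma> \<phi>"
    and J: "J \<in> carrier \<Gamma>" "J \<otimes>\<^bsub>\<Gamma>\<^esub> J = \<one>\<^bsub>\<Gamma>\<^esub>" and p: "1 \<le> p" and q: "1 \<le> q"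
    and near: "\<forall>\<^sub>F n in sequentially. schatten_dist q n (\<phi> n J) (1\<^sub>m n) < 1"
  shows "(\<lambda>n. schatten_dist (ereal p) n (\<phi> n J) (1\<^sub>m n)) \<longlonglongrightarrow> 0"
proof -
  interpret group \<Gamma> by (rule G)
  have in_U: "\<phi> n g \<in> carrier (unitary_group n)" if "g \<in> carrier \<Gamma>" for n g
    using hom that by (auto simp: asymptotic_hom_def)
  have lim: "(\<lambda>n. schatten_dist (ereal p) n (\<phi> n (g \<otimes>\<^bsub>\<Gamma>\<^esub> h)) (\<phi> n g * \<phi> n h)) \<longlonglongrightarrow> 0"
    if "g \<in> carrier \<Gamma>" "h \<in> carrier \<Gamma>" for g h
    using hom that by (simp add: asymptotic_hom_def)
  let ?E = "\<lambda>n. \<phi> n \<one>\<^bsub>\<Gamma>\<^esub>"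
  have "(\<lambda>n. schatten_dist (ereal p) n (?E n) (?E n * ?E n)) \<longlonglongrightarrow> 0"
    using lim[OF one_closed one_closed] by simp
  then have E: "(\<lambda>n. schatten_dist (ereal p) n (?E n) (1\<^sub>m n)) \<longlonglongrightarrow> 0"
    by (simp only: schatten_dist_square_self[OF in_U[OF one_closed]])
  have JJ: "(\<lambda>n. schatten_dist (ereal p) n (?E n) (\<phi> n J * \<phi> n J)) \<longlonglongrightarrow> 0"
    using lim[OF J(1) J(1)] by (simp only: J(2))
  let ?bound = "\<lambda>n. 2 * (schatten_dist (ereal p) n (?E n) (\<phi> n J * \<phi> n J) + schatten_dist (ereal p) n (?E n) (1\<^sub>m n))"
  have bound: "?bound \<longlonglongrightarrow> 0"
    using tendsto_mult_right_zero[OF tendsto_add_zero[OF JJ E], of 2] .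
  show ?thesis
  proof (rule tendsto_sandwich[OF _ _ tendsto_const bound])
    show "\<forall>\<^sub>F n in sequentially. 0 \<le> schatten_dist (ereal p) n (\<phi> n J) (1\<^sub>m n)"
      by (intro always_eventually allI schatten_dist_nonneg in_U J unitary_one) (use p in simp)
    show "\<forall>\<^sub>F n in sequentially. schatten_dist (ereal p) n (\<phi> n J) (1\<^sub>m n) \<le> ?bound n"
      using near by eventually_elim
        (rule dist_one_le_of_almost_involution[OF in_U[OF J(1)] in_U[OF one_closed] p q])
  qed
qed

text \<open>
  The involution \<open>J\<close> contradicts separation: stability and residual finiteness push \<open>\<phi>\<^sub>n(J)\<close> to \<open>1\<close> in
  the \<open>q\<close>-norm, and being almost an involution it is then pushed to \<open>1\<close> in the \<open>p\<close>-norm.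
\<close>

lemma deligne_type_stable_not_approximated:
  assumes \<Gamma>: "deligne_type \<Gamma>" and p: "1 \<le> p" and q: "p \<le> q" and stable: "schatten_stable q \<Gamma>"
  shows "\<not> schatten_approximated p \<Gamma>"
proof
  assume "schatten_approximated p \<Gamma>"
  then obtain \<phi> where hom: "asymptotic_hom unitary_group (schatten_dist p) \<Gamma> \<phi>"
    and sep: "\<And>g. g \<in> carrier \<Gamma> - {\<one>\<^bsub>\<Gamma>\<^esub>} \<Longrightarrow>
      liminf (\<lambda>n. ereal (schatten_dist p n (\<phi> n g) \<one>\<^bsub>unitary_group n\<^esub>)) > 0"
    unfolding approximated_def by blast
  have fg: "finitely_generated_group \<Gamma>" using \<Gamma> by (simp add: deligne_type_def)
  obtain J where J: "J \<in> carrier \<Gamma>" and J2: "group.ord \<Gamma> J = 2" and JR: "J \<in> ker_RF \<Gamma>"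
    using \<Gamma> by (auto simp: deligne_type_def)
  interpret group \<Gamma> using fg by (simp add: finitely_generated_group_def)
  have JJ: "J \<otimes>\<^bsub>\<Gamma>\<^esub> J = \<one>\<^bsub>\<Gamma>\<^esub>" using pow_ord_eq_1[OF J] J by (simp add: J2 numeral_2_eq_2)
  have J1: "J \<noteq> \<one>\<^bsub>\<Gamma>\<^esub>" using J2 ord_eq_1[OF J] by auto
  obtain \<psi> where \<psi>: "\<And>n. \<psi> n \<in> hom \<Gamma> (unitary_group n)"
    and close: "\<And>g. g \<in> carrier \<Gamma> \<Longrightarrow> (\<lambda>n. schatten_dist q n (\<phi> n g) (\<psi> n g)) \<longlonglongrightarrow> 0"
    using stable asymptotic_hom_antimono[OF is_group hom p q] unfolding stable_def by blast
  have limq: "(\<lambda>n. schatten_dist q n (\<phi> n J) (1\<^sub>m n)) \<longlonglongrightarrow> 0"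
    using close[OF J] by (simp only: hom_unitary_ker_RF[OF fg \<psi> JR])
  have limp: "(\<lambda>n. schatten_dist p n (\<phi> n J) (1\<^sub>m n)) \<longlonglongrightarrow> 0"
    using p
  proof (cases p rule: ereal_ge_1_cases)
    case 1
    then have "q = p" using q by simp
    then show ?thesis using limq by simp
  next
    case (2 r)
    have "\<forall>\<^sub>F n in sequentially. schatten_dist q n (\<phi> n J) (1\<^sub>m n) < 1"
      by (rule order_tendstoD(2)[OF limq]) simp
    moreover have "1 \<le> q" using p q by simp
    ultimately show ?thesis
      using dist_one_tendsto_zero_of_near[OF is_group _ J JJ] hom 2 by simp
  qed
  have "(\<lambda>n. ereal (schatten_dist p n (\<phi> n J) (1\<^sub>m n))) \<longlonglongrightarrow> ereal 0"
    using limp by (rule tendsto_ereal)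
  then have "liminf (\<lambda>n. ereal (schatten_dist p n (\<phi> n J) (1\<^sub>m n))) = ereal 0"
    by (rule lim_imp_Liminf[OF sequentially_bot])
  then show False using sep[of J] J J1 by simp
qed

theorem theorem1p3:
  fixes \<Gamma> :: "('a, 'b) monoid_scheme"
  assumes "deligne_type \<Gamma>"
  shows "(\<forall>p q :: ereal. 1 \<le> p \<and> p \<le> q \<and> q \<le> \<infinity> \<longrightarrow>
            schatten_stable q \<Gamma> \<longrightarrow> \<not> schatten_approximated p \<Gamma>) \<and>
         (frobenius_stable \<Gamma> \<longrightarrow>
            (\<forall>p :: ereal. 1 \<le> p \<and> p \<le> 2 \<longrightarrow> \<not> schatten_approximated p \<Gamma>))"
  using deligne_type_stable_not_approximated[OF assms] by blast

end
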